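(* Let $\mu$ be a probability on $(E,\mathscr{E})$ and $Q$ a $\mu$-isometric involution. Let $\{P_{t,1}\}$, $\{P_{t,2}\}$ be strongly continuous Markov semigroups on $L^{2}(\mu)$ with invariant distribution $\mu$, both $(\mu,Q)$-self-adjoint, with generators $(L_{1},\mathcal{D}^{2}(L_{1},\mu))$, $(L_{2},\mathcal{D}^{2}(L_{2},\mu))$. Assume: (a) $L_{1},L_{2}$ have a common core $\mathcal{A}$, dense in $L^{2}(\mu)$, with $Q\mathcal{A}\subset\mathcal{A}$; (b) for every $\beta\in[1,2]$ the operator $(2-\beta)L_{1}+(\beta-1)L_{2}$ on $\mathcal{D}^{2}(L_{1},\mu)\cap\mathcal{D}^{2}(L_{2},\mu)$ has an extension defining a unique strongly continuous contraction semigroup $\{P_{t}(\beta),t\geq0\}$ on $L^{2}(\mu)$ with invariant distribution $\mu$ and closed generator $(L(\beta),\mathcal{D}^{2}(L(\beta),\mu))$, and $P_{t}(\beta)f\in\mathcal{A}$ for all $f\in\mathcal{A}$, $t\geq0$. For $\lambda>0$ let $R_{\lambda}(\beta)f=\int_{0}^{\infty}e^{-\lambda t}P_{t}(\beta)f\,{\rm d}t$. Assume further that for any $\lambda>0$, $\beta\in[1,2]$ and $f\in\mathcal{A}$: (1) $R_{\lambda}(\beta)f\in\mathcal{D}^{2}(L_{1},\mu)\cap\mathcal{D}^{2}(L_{2},\mu)$ and there exist $g_{n}(\beta)\in\mathcal{A}$, $n\in\mathbb{N}$, with $\lim_{n}(L_{1}-L_{2})g_{n}(\beta)=(L_{1}-L_{2})R_{\lambda}(\beta)f$;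 (2) $[1,2)\ni\beta\mapsto R_{\lambda}(\beta)f$ is right differentiable in $L^{2}(\mu)$ with $\partial_{\beta}R_{\lambda}(\beta)f=R_{\lambda}(\beta)(L_{2}-L_{1})R_{\lambda}(\beta)f$, and $\beta\mapsto\langle f,\partial_{\beta}R_{\lambda}(\beta)f\rangle_{\mu}$ is continuous; (3) either $\mathcal{E}(g,QL_{1}-QL_{2})\geq0$ for all $g\in\mathcal{A}$, or $\mathcal{E}(g,L_{1}Q-L_{2}Q)\geq0$ for all $g\in\mathcal{A}$. Then (i) for any $f\in\mathcal{A}$ with $Qf=f$ and $\beta\in[1,2)$, \[\partial_{\beta}\langle f,R_{\lambda}(\beta)f\rangle_{\mu}=\mathcal{E}(QR_{\lambda}(\beta)f,L_{1}Q-L_{2}Q)=\mathcal{E}(R_{\lambda}(\beta)f,QL_{1}-QL_{2})\geq0;\] (ii) for any $f\in L^{2}(\mu)$ with $Qf=f$, ${\rm var}_{\lambda}(f,L_{1})=2\langle f,R_{\lambda}(1)f\rangle_{\mu}\leq{\rm var}_{\lambda}(f,L_{2})=2\langle f,R_{\lambda}(2)f\rangle_{\mu}$.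
   Context: Generator domains: $\mathcal{D}^{2}(L,\mu)=\{f:\lim_{t\downarrow0}\|t^{-1}(P_{t}-{\rm Id})f-Lf\|_{\mu}=0\}$. A $\mu$-isometric involution is linear $Q$ on $L^{2}(\mu)$ with $\langle Qf,Qg\rangle_{\mu}=\langle f,g\rangle_{\mu}$, $Q^{2}={\rm Id}$. $(\mu,Q)$-self-adjoint semigroup: $\langle P_{t}f,g\rangle_{\mu}=\langle f,QP_{t}Qg\rangle_{\mu}$ for all $f,g,t$. A core is a subspace of the domain on which the restriction has closure equal to the generator. For an operator $A$, $\mathcal{E}(g,A)=\langle g,-Ag\rangle_{\mu}$. For a semigroup with generator $L$ and $\lambda>0$, ${\rm var}_{\lambda}(f,L)=2\langle f,R_{\lambda}f\rangle_{\mu}$ with $R_{\lambda}f=\int_{0}^{\infty}e^{-\lambda t}P_{t}f\,{\rm d}t$. *)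

theory Defs
  imports "HOL-Probability.Probability"
begin

text \<open>Elements of L2(mu) are represented by real-valued functions on the
  underlying space, identified up to mu-a.e. equality (eqL2).  Operators are
  maps on such functions; all statements are relativised to L2 and a.e. equality.\<close>

definition L2 :: "'e measure \<Rightarrow> ('e \<Rightarrow> real) set" where
  "L2 M = {f. f \<in> borel_measurable M \<and> integrable M (\<lambda>x. (f x)\<^sup>2)}"

definition ipL2 :: "'e measure \<Rightarrow> ('e \<Rightarrow> real) \<Rightarrow> ('e \<Rightarrow> real) \<Rightarrow> real" where
  "ipL2 M f g = (\<integral>x. f x * g x \<partial>M)"

definition nrmL2 :: "'e measure \<Rightarrow> ('e \<Rightarrow> real) \<Rightarrow> real" where
  "nrmL2 M f = sqrt (\<integral>x. (f x)\<^sup>2 \<partial>M)"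

definition eqL2 :: "'e measure \<Rightarrow> ('e \<Rightarrow> real) \<Rightarrow> ('e \<Rightarrow> real) \<Rightarrow> bool" where
  "eqL2 M f g \<longleftrightarrow> (AE x in M. f x = g x)"

definition convL2 :: "'e measure \<Rightarrow> (nat \<Rightarrow> 'e \<Rightarrow> real) \<Rightarrow> ('e \<Rightarrow> real) \<Rightarrow> bool" where
  "convL2 M a f \<longleftrightarrow> (\<lambda>n. nrmL2 M (\<lambda>x. a n x - f x)) \<longlonglongrightarrow> 0"

definition L2_op :: "'e measure \<Rightarrow> (('e \<Rightarrow> real) \<Rightarrow> ('e \<Rightarrow> real)) \<Rightarrow> bool" where
  "L2_op M T \<longleftrightarrow>
     (\<forall>f\<in>L2 M. T f \<in> L2 M) \<and>
     (\<forall>f\<in>L2 M. \<forall>g\<in>L2 M. eqL2 M f g \<longrightarrow> eqL2 M (T f) (T g)) \<and>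
     (\<forall>f\<in>L2 M. \<forall>g\<in>L2 M. \<forall>a b::real.
        eqL2 M (T (\<lambda>x. a * f x + b * g x)) (\<lambda>x. a * T f x + b * T g x))"

definition sc_semigroup :: "'e measure \<Rightarrow> (real \<Rightarrow> ('e \<Rightarrow> real) \<Rightarrow> ('e \<Rightarrow> real)) \<Rightarrow> bool" where
  "sc_semigroup M P \<longleftrightarrow>
     (\<forall>t\<ge>0. L2_op M (P t)) \<and>
     (\<forall>f\<in>L2 M. eqL2 M (P 0 f) f) \<and>
     (\<forall>s\<ge>0. \<forall>t\<ge>0. \<forall>f\<in>L2 M. eqL2 M (P (s + t) f) (P s (P t f))) \<and>
     (\<forall>f\<in>L2 M. ((\<lambda>t. nrmL2 M (\<lambda>x. P t f x - f x)) \<longlongrightarrow> 0) (at_right 0))"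

definition sc_contraction_semigroup :: "'e measure \<Rightarrow> (real \<Rightarrow> ('e \<Rightarrow> real) \<Rightarrow> ('e \<Rightarrow> real)) \<Rightarrow> bool" where
  "sc_contraction_semigroup M P \<longleftrightarrow>
     sc_semigroup M P \<and> (\<forall>t\<ge>0. \<forall>f\<in>L2 M. nrmL2 M (P t f) \<le> nrmL2 M f)"

definition sc_markov_semigroup :: "'e measure \<Rightarrow> (real \<Rightarrow> ('e \<Rightarrow> real) \<Rightarrow> ('e \<Rightarrow> real)) \<Rightarrow> bool" where
  "sc_markov_semigroup M P \<longleftrightarrow>
     sc_semigroup M P \<and>
     (\<forall>t\<ge>0. \<forall>f\<in>L2 M. (AE x in M. 0 \<le> f x) \<longrightarrow> (AE x in M. 0 \<le> P t f x)) \<and>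
     (\<forall>t\<ge>0. eqL2 M (P t (\<lambda>_. 1)) (\<lambda>_. 1))"

definition invariant_distr :: "'e measure \<Rightarrow> (real \<Rightarrow> ('e \<Rightarrow> real) \<Rightarrow> ('e \<Rightarrow> real)) \<Rightarrow> bool" where
  "invariant_distr M P \<longleftrightarrow> (\<forall>t\<ge>0. \<forall>f\<in>L2 M. (\<integral>x. P t f x \<partial>M) = (\<integral>x. f x \<partial>M))"

definition gen_dom :: "'e measure \<Rightarrow> (real \<Rightarrow> ('e \<Rightarrow> real) \<Rightarrow> ('e \<Rightarrow> real)) \<Rightarrow> ('e \<Rightarrow> real) set" where
  "gen_dom M P = {f \<in> L2 M. \<exists>g\<in>L2 M.
     ((\<lambda>t. nrmL2 M (\<lambda>x. (P t f x - f x) / t - g x)) \<longlongrightarrow> 0) (at_right 0)}"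

definition gen :: "'e measure \<Rightarrow> (real \<Rightarrow> ('e \<Rightarrow> real) \<Rightarrow> ('e \<Rightarrow> real)) \<Rightarrow> ('e \<Rightarrow> real) \<Rightarrow> ('e \<Rightarrow> real)" where
  "gen M P f = (SOME g. g \<in> L2 M \<and>
     ((\<lambda>t. nrmL2 M (\<lambda>x. (P t f x - f x) / t - g x)) \<longlongrightarrow> 0) (at_right 0))"

definition closed_generator :: "'e measure \<Rightarrow> (real \<Rightarrow> ('e \<Rightarrow> real) \<Rightarrow> ('e \<Rightarrow> real)) \<Rightarrow> bool" where
  "closed_generator M P \<longleftrightarrow>
     (\<forall>a f g. (\<forall>n. a n \<in> gen_dom M P) \<and> f \<in> L2 M \<and> g \<in> L2 M \<and> convL2 M a f \<and>
        convL2 M (\<lambda>n. gen M P (a n)) g \<longrightarrow> f \<in> gen_dom M P \<and> eqL2 M (gen M P f) g)"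

definition is_core :: "'e measure \<Rightarrow> (real \<Rightarrow> ('e \<Rightarrow> real) \<Rightarrow> ('e \<Rightarrow> real)) \<Rightarrow> ('e \<Rightarrow> real) set \<Rightarrow> bool" where
  "is_core M P A \<longleftrightarrow>
     A \<subseteq> gen_dom M P \<and>
     (\<forall>f\<in>A. \<forall>g\<in>A. \<forall>a b::real. (\<lambda>x. a * f x + b * g x) \<in> A) \<and>
     (\<forall>f\<in>L2 M. \<forall>g\<in>L2 M.
        (\<exists>a. (\<forall>n. a n \<in> A) \<and> convL2 M a f \<and> convL2 M (\<lambda>n. gen M P (a n)) g)
        \<longleftrightarrow> (f \<in> gen_dom M P \<and> eqL2 M (gen M P f) g))"

definition dense_L2 :: "'e measure \<Rightarrow> ('e \<Rightarrow> real) set \<Rightarrow> bool" where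
  "dense_L2 M A \<longleftrightarrow> A \<subseteq> L2 M \<and>
     (\<forall>f\<in>L2 M. \<forall>e>0. \<exists>a\<in>A. nrmL2 M (\<lambda>x. f x - a x) < e)"

definition iso_involution :: "'e measure \<Rightarrow> (('e \<Rightarrow> real) \<Rightarrow> ('e \<Rightarrow> real)) \<Rightarrow> bool" where
  "iso_involution M Q \<longleftrightarrow> L2_op M Q \<and>
     (\<forall>f\<in>L2 M. \<forall>g\<in>L2 M. ipL2 M (Q f) (Q g) = ipL2 M f g) \<and>
     (\<forall>f\<in>L2 M. eqL2 M (Q (Q f)) f)"

definition Q_selfadjoint :: "'e measure \<Rightarrow> (('e \<Rightarrow> real) \<Rightarrow> ('e \<Rightarrow> real)) \<Rightarrow> (real \<Rightarrow> ('e \<Rightarrow> real) \<Rightarrow> ('e \<Rightarrow> real)) \<Rightarrow> bool" where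
  "Q_selfadjoint M Q P \<longleftrightarrow>
     (\<forall>t\<ge>0. \<forall>f\<in>L2 M. \<forall>g\<in>L2 M. ipL2 M (P t f) g = ipL2 M f (Q (P t (Q g))))"

text \<open>Resolvent R_lambda f = int_0^infty exp(-lambda t) P_t f dt, the L2-valued
  integral being characterised (as the Pettis/Bochner integral) by its pairings
  with all g in L2.\<close>
definition resolvent :: "'e measure \<Rightarrow> (real \<Rightarrow> ('e \<Rightarrow> real) \<Rightarrow> ('e \<Rightarrow> real)) \<Rightarrow> real \<Rightarrow> ('e \<Rightarrow> real) \<Rightarrow> ('e \<Rightarrow> real)" where
  "resolvent M P lam f = (SOME r. r \<in> L2 M \<and>
     (\<forall>g\<in>L2 M. ipL2 M r g = (LBINT t:{0..}. exp (- lam * t) * ipL2 M (P t f) g)))"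

definition energy :: "'e measure \<Rightarrow> ('e \<Rightarrow> real) \<Rightarrow> (('e \<Rightarrow> real) \<Rightarrow> ('e \<Rightarrow> real)) \<Rightarrow> real" where
  "energy M g A = ipL2 M g (\<lambda>x. - A g x)"

definition var_lam :: "'e measure \<Rightarrow> (real \<Rightarrow> ('e \<Rightarrow> real) \<Rightarrow> ('e \<Rightarrow> real)) \<Rightarrow> real \<Rightarrow> ('e \<Rightarrow> real) \<Rightarrow> real" where
  "var_lam M P lam f = 2 * ipL2 M f (resolvent M P lam f)"

end

theory Submission
  imports Defs
begin

text \<open>Write \<open>u = R\<^sub>\<lambda>(\<beta>) f\<close> and \<open>q x y = \<langle>Q x, (L\<^sub>2 - L\<^sub>1) y\<rangle>\<close>, a symmetric form on the common
  domain which is nonnegative on \<open>A\<close>. Since \<open>A\<close> is dense and invariant under \<open>P\<^sub>t(\<beta>)\<close>, it is a core for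
  \<open>L(\<beta>)\<close>, so \<open>(\<lambda> - L(\<beta>)) u = f\<close> and \<open>Q R\<^sub>\<lambda>(\<beta>)\<close> is symmetric. For \<open>Q f = f\<close> this gives
  \<open>\<langle>f, R\<^sub>\<lambda>(c) f\<rangle> - \<langle>f, R\<^sub>\<lambda>(b) f\<rangle> = (c - b) q (R\<^sub>\<lambda>(c) f) (R\<^sub>\<lambda>(b) f)\<close>, hence the derivative is \<open>q u u\<close>.

  That \<open>q u u \<ge> 0\<close> although \<open>u\<close> need not lie in \<open>A\<close>: splitting into \<open>Q\<close>-even and \<open>Q\<close>-odd parts shows that
  on \<open>A\<close> the form \<open>q\<close> is bounded by a multiple of the dissipation form \<open>-\<langle>x, L(\<beta>) x\<rangle>\<close> when
  \<open>1 < \<beta> < 2\<close>, so \<open>q\<close> passes to the limit along approximations of \<open>u\<close> in the graph norm of \<open>L(\<beta>)\<close>;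
  the case \<open>\<beta> = 1\<close> follows by continuity. Finally \<open>P\<^sub>1 = P(1)\<close> and \<open>P\<^sub>2 = P(2)\<close> by uniqueness, once
  Markov semigroups with invariant \<open>\<mu>\<close> are known to be contractive on \<open>L\<^sup>2(\<mu>)\<close>.\<close>

section \<open>The space of square integrable functions\<close>

text \<open>The obstacle is that a sequence from \<open>A\<close> approximating u in the graph norm
  of L(\<beta>) need not approximate it in the graph norms of the two given generators, so the
  diagonal values of \<open>q\<close> along it need not obviously converge. With one slot fixed in
  the common domain, however, \<open>q\<close> is continuous in the other slot for the plain norm.
  The domination is therefore applied to differences, which yields mixed values of \<open>q\<close>,
  and the limit is taken one slot at a time. The domination factor is the minimum of 2 - \<beta> and
  \<beta> - 1, because the even part is paid for by the share of L1 and the odd part by the share of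
  L2. It vanishes at the endpoints, whence the separate limit at \<beta> = 1. The resolvent is a
  vector chosen by its pairings, so its existence has to be shown. It arises as a limit of preimages
  under \<lambda> - L of vectors approximating f, not by constructing a vector-valued
  integral.\<close>

lemma L2_measurable: "f \<in> L2 M \<Longrightarrow> f \<in> borel_measurable M"
  by (simp add: L2_def)

lemma L2_integrable_mult:
  assumes "f \<in> L2 M" "g \<in> L2 M"
  shows "integrable M (\<lambda>x. f x * g x)"
proof (rule Bochner_Integration.integrable_bound)
  show "integrable M (\<lambda>x. (f x)\<^sup>2 + (g x)\<^sup>2)"
    using assms by (auto simp: L2_def)
  show "(\<lambda>x. f x * g x) \<in> borel_measurable M"
    using assms by (auto simp: L2_def)
  show "AE x in M. norm (f x * g x) \<le> norm ((f x)\<^sup>2 + (g x)\<^sup>2)"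
  proof (rule AE_I2)
    fix x
    have "2 * \<bar>f x * g x\<bar> \<le> (f x)\<^sup>2 + (g x)\<^sup>2"
      using sum_squares_bound[of "\<bar>f x\<bar>" "\<bar>g x\<bar>"] by (simp add: abs_mult)
    then show "norm (f x * g x) \<le> norm ((f x)\<^sup>2 + (g x)\<^sup>2)" by simp
  qed
qed

lemma L2_lincomb:
  assumes "f \<in> L2 M" "g \<in> L2 M"
  shows "(\<lambda>x. a * f x + b * g x) \<in> L2 M"
proof -
  have eq: "(a * f x + b * g x)\<^sup>2 = a\<^sup>2 * (f x)\<^sup>2 + b\<^sup>2 * (g x)\<^sup>2 + (2 * a * b) * (f x * g x)" for x
    by (simp add: power2_eq_square algebra_simps)
  have "integrable M (\<lambda>x. a\<^sup>2 * (f x)\<^sup>2 + b\<^sup>2 * (g x)\<^sup>2 + (2 * a * b) * (f x * g x))"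
    using assms L2_integrable_mult[OF assms]
    by (intro Bochner_Integration.integrable_add integrable_mult_right) (auto simp: L2_def)
  then have "integrable M (\<lambda>x. (a * f x + b * g x)\<^sup>2)"
    by (simp only: eq)
  moreover have "(\<lambda>x. a * f x + b * g x) \<in> borel_measurable M"
    using assms by (auto simp: L2_def)
  ultimately show ?thesis by (simp add: L2_def)
qed

lemma L2_add [simp, intro]: "f \<in> L2 M \<Longrightarrow> g \<in> L2 M \<Longrightarrow> (\<lambda>x. f x + g x) \<in> L2 M"
  using L2_lincomb[of f M g 1 1] by simp

lemma L2_diff [simp, intro]: "f \<in> L2 M \<Longrightarrow> g \<in> L2 M \<Longrightarrow> (\<lambda>x. f x - g x) \<in> L2 M"
  using L2_lincomb[of f M g 1 "-1"] by simp

lemma L2_scale [simp, intro]: "f \<in> L2 M \<Longrightarrow> (\<lambda>x. a * f x) \<in> L2 M"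
  using L2_lincomb[of f M f a 0] by simp

lemma L2_uminus [simp, intro]: "f \<in> L2 M \<Longrightarrow> (\<lambda>x. - f x) \<in> L2 M"
  using L2_lincomb[of f M f "-1" 0] by simp

lemma L2_divide [simp, intro]: "f \<in> L2 M \<Longrightarrow> (\<lambda>x. f x / a) \<in> L2 M"
  using L2_lincomb[of f M f "1 / a" 0] by simp

section \<open>The pairing, almost everywhere equality and the norm\<close>

lemma ipL2_commute: "ipL2 M f g = ipL2 M g f"
  by (simp add: ipL2_def mult.commute)

lemma ipL2_add_left:
  "f \<in> L2 M \<Longrightarrow> g \<in> L2 M \<Longrightarrow> h \<in> L2 M \<Longrightarrow> ipL2 M (\<lambda>x. f x + g x) h = ipL2 M f h + ipL2 M g h"
  by (simp add: ipL2_def distrib_right L2_integrable_mult)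

lemma ipL2_diff_left:
  "f \<in> L2 M \<Longrightarrow> g \<in> L2 M \<Longrightarrow> h \<in> L2 M \<Longrightarrow> ipL2 M (\<lambda>x. f x - g x) h = ipL2 M f h - ipL2 M g h"
  by (simp add: ipL2_def left_diff_distrib L2_integrable_mult)

lemma ipL2_scale_left: "ipL2 M (\<lambda>x. a * f x) h = a * ipL2 M f h"
  by (simp add: ipL2_def mult.assoc)

lemma ipL2_uminus_left: "ipL2 M (\<lambda>x. - f x) h = - ipL2 M f h"
  by (simp add: ipL2_def)

lemma ipL2_divide_left: "ipL2 M (\<lambda>x. f x / a) h = ipL2 M f h / a"
  using ipL2_scale_left[of M "1 / a" f h] by simp

lemma ipL2_add_right:
  "f \<in> L2 M \<Longrightarrow> g \<in> L2 M \<Longrightarrow> h \<in> L2 M \<Longrightarrow> ipL2 M h (\<lambda>x. f x + g x) = ipL2 M h f + ipL2 M h g"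
  by (simp add: ipL2_def distrib_left L2_integrable_mult)

lemma ipL2_diff_right:
  "f \<in> L2 M \<Longrightarrow> g \<in> L2 M \<Longrightarrow> h \<in> L2 M \<Longrightarrow> ipL2 M h (\<lambda>x. f x - g x) = ipL2 M h f - ipL2 M h g"
  by (simp add: ipL2_def right_diff_distrib L2_integrable_mult)

lemma ipL2_scale_right: "ipL2 M h (\<lambda>x. a * f x) = a * ipL2 M h f"
  by (metis ipL2_commute ipL2_scale_left)

lemma ipL2_uminus_right: "ipL2 M h (\<lambda>x. - f x) = - ipL2 M h f"
  by (metis ipL2_commute ipL2_uminus_left)

lemma ipL2_divide_right: "ipL2 M h (\<lambda>x. f x / a) = ipL2 M h f / a"
  by (metis ipL2_commute ipL2_divide_left)

lemmas ipL2_linear = ipL2_add_left ipL2_diff_left ipL2_scale_left ipL2_uminus_left ipL2_divide_left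
  ipL2_add_right ipL2_diff_right ipL2_scale_right ipL2_uminus_right ipL2_divide_right

lemma eqL2_sym: "eqL2 M f g \<Longrightarrow> eqL2 M g f"
  by (auto simp: eqL2_def elim: eventually_mono)

text \<open>Operator identities hold only almost everywhere and cannot be used for rewriting. These
  rules reduce a derived identity to pointwise algebra under the given ones, without measurability
  conditions.\<close>

lemma eqL2_imp: "eqL2 M f g \<Longrightarrow> (\<And>x. f x = g x \<Longrightarrow> F x = G x) \<Longrightarrow> eqL2 M F G"
  unfolding eqL2_def by (erule eventually_mono) blast

lemma eqL2_imp2:
  assumes "eqL2 M f g" "eqL2 M f' g'" "\<And>x. f x = g x \<Longrightarrow> f' x = g' x \<Longrightarrow> F x = G x"
  shows "eqL2 M F G"
  using assms(1,2) unfolding eqL2_def by eventually_elim (rule assms(3))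

lemma eqL2_imp3:
  assumes "eqL2 M f g" "eqL2 M f' g'" "eqL2 M f'' g''"
    "\<And>x. f x = g x \<Longrightarrow> f' x = g' x \<Longrightarrow> f'' x = g'' x \<Longrightarrow> F x = G x"
  shows "eqL2 M F G"
  using assms(1-3) unfolding eqL2_def by eventually_elim (rule assms(4))

lemma ipL2_cong_left:
  assumes "eqL2 M f f'" "f \<in> L2 M" "f' \<in> L2 M" "g \<in> L2 M"
  shows "ipL2 M f g = ipL2 M f' g"
  unfolding ipL2_def using assms
  by (intro integral_cong_AE) (auto simp: eqL2_def L2_def)

lemma ipL2_cong_right:
  assumes "eqL2 M f f'" "f \<in> L2 M" "f' \<in> L2 M" "g \<in> L2 M"
  shows "ipL2 M g f = ipL2 M g f'"
  using ipL2_cong_left[OF assms] by (metis ipL2_commute)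

lemma ipL2_nonneg: "0 \<le> ipL2 M f f"
  by (simp add: ipL2_def)

lemma nrmL2_eq_sqrt_ip: "nrmL2 M f = sqrt (ipL2 M f f)"
  by (simp add: nrmL2_def ipL2_def power2_eq_square)

lemma nrmL2_nonneg [simp]: "0 \<le> nrmL2 M f"
  by (simp add: nrmL2_eq_sqrt_ip ipL2_nonneg)

lemma nrmL2_sq: "(nrmL2 M f)\<^sup>2 = ipL2 M f f"
  by (simp add: nrmL2_eq_sqrt_ip ipL2_nonneg)

lemma nrmL2_cong:
  assumes "eqL2 M f f'" "f \<in> L2 M" "f' \<in> L2 M"
  shows "nrmL2 M f = nrmL2 M f'"
  using ipL2_cong_left[OF assms assms(2)] ipL2_cong_right[OF assms assms(3)]
  by (simp add: nrmL2_eq_sqrt_ip)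

lemma nrmL2_scale: "nrmL2 M (\<lambda>x. a * f x) = \<bar>a\<bar> * nrmL2 M f"
  by (simp add: nrmL2_def power_mult_distrib real_sqrt_mult)

lemma nrmL2_minus_commute: "nrmL2 M (\<lambda>x. f x - g x) = nrmL2 M (\<lambda>x. g x - f x)"
  by (simp add: nrmL2_def power2_commute)

text \<open>The discriminant of a quadratic that is nonnegative on the line. It is kept to bare
  reals because it serves twice: for the inner product, and with an error as constant term in the
  projection argument.\<close>

lemma nonneg_form_Cauchy_Schwarz:
  fixes a b c :: real
  assumes "\<And>t. 0 \<le> a + 2 * t * b + t\<^sup>2 * c" "0 \<le> c"
  shows "b\<^sup>2 \<le> a * c"
proof (cases "c = 0")
  case True
  show ?thesis
  proof (cases "b = 0")
    case False
    \<comment> \<open>With \<open>c = 0\<close> the quadratic is affine, and this value of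
      \<open>t\<close> makes it equal to -1.\<close>
    have "0 \<le> a + 2 * (- (a + 1) / (2 * b)) * b + 0"
      using assms(1)[of "- (a + 1) / (2 * b)"] True by simp
    then show ?thesis using False by (simp add: field_simps)
  qed (simp add: True)
next
  case False
  have c: "0 < c" using False assms(2) by simp
  have "0 \<le> a + 2 * (- b / c) * b + (- b / c)\<^sup>2 * c" by (rule assms(1))
  also have "\<dots> = a - b\<^sup>2 / c" using c by (simp add: field_simps power2_eq_square)
  finally show ?thesis using c by (simp add: field_simps)
qed

lemma ipL2_Cauchy_Schwarz:
  assumes "f \<in> L2 M" "g \<in> L2 M"
  shows "\<bar>ipL2 M f g\<bar> \<le> nrmL2 M f * nrmL2 M g"
proof -
  have "(ipL2 M f g)\<^sup>2 \<le> ipL2 M f f * ipL2 M g g"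
  proof (rule nonneg_form_Cauchy_Schwarz)
    fix t
    have "0 \<le> ipL2 M (\<lambda>x. f x + t * g x) (\<lambda>x. f x + t * g x)" by (rule ipL2_nonneg)
    also have "\<dots> = ipL2 M f f + 2 * t * ipL2 M f g + t\<^sup>2 * ipL2 M g g"
      using assms by (simp add: ipL2_linear ipL2_commute[of M g f] power2_eq_square algebra_simps)
    finally show "0 \<le> ipL2 M f f + 2 * t * ipL2 M f g + t\<^sup>2 * ipL2 M g g" .
  qed (rule ipL2_nonneg)
  then have "(ipL2 M f g)\<^sup>2 \<le> (nrmL2 M f * nrmL2 M g)\<^sup>2"
    by (simp add: power_mult_distrib nrmL2_sq)
  then show ?thesis
    by (metis abs_le_square_iff abs_of_nonneg mult_nonneg_nonneg nrmL2_nonneg)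
qed

lemma nrmL2_triangle:
  assumes "f \<in> L2 M" "g \<in> L2 M"
  shows "nrmL2 M (\<lambda>x. f x + g x) \<le> nrmL2 M f + nrmL2 M g"
proof (rule power2_le_imp_le)
  have "(nrmL2 M (\<lambda>x. f x + g x))\<^sup>2 = (nrmL2 M f)\<^sup>2 + 2 * ipL2 M f g + (nrmL2 M g)\<^sup>2"
    using assms by (simp add: nrmL2_sq ipL2_linear ipL2_commute[of M g f])
  also have "\<dots> \<le> (nrmL2 M f + nrmL2 M g)\<^sup>2"
    using ipL2_Cauchy_Schwarz[OF assms] by (simp add: power2_sum)
  finally show "(nrmL2 M (\<lambda>x. f x + g x))\<^sup>2 \<le> (nrmL2 M f + nrmL2 M g)\<^sup>2" .
qed simp

lemma nrmL2_triangle3: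
  assumes "f \<in> L2 M" "g \<in> L2 M" "h \<in> L2 M"
  shows "nrmL2 M (\<lambda>x. f x - h x) \<le> nrmL2 M (\<lambda>x. f x - g x) + nrmL2 M (\<lambda>x. g x - h x)"
  using nrmL2_triangle[of "\<lambda>x. f x - g x" M "\<lambda>x. g x - h x"] assms by simp

lemma eqL2_iff_nrmL2:
  assumes "f \<in> L2 M" "g \<in> L2 M"
  shows "eqL2 M f g \<longleftrightarrow> nrmL2 M (\<lambda>x. f x - g x) = 0"
proof -
  have "integrable M (\<lambda>x. (f x - g x)\<^sup>2)"
    using L2_diff[OF assms] by (simp add: L2_def)
  from integral_nonneg_eq_0_iff_AE[OF this] show ?thesis
    by (simp add: eqL2_def nrmL2_def)
qed

lemma eqL2_if_ipL2_eq:
  assumes "f \<in> L2 M" "g \<in> L2 M" "\<And>h. h \<in> L2 M \<Longrightarrow> ipL2 M f h = ipL2 M g h"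
  shows "eqL2 M f g"
proof -
  have "ipL2 M (\<lambda>x. f x - g x) (\<lambda>x. f x - g x) = 0"
    using assms(1,2) by (subst ipL2_diff_left) (auto simp: assms(3))
  then show ?thesis using assms by (simp add: eqL2_iff_nrmL2 nrmL2_eq_sqrt_ip)
qed

text \<open>The filter parameter covers n to infinity, t to 0 from the right and the limits in
  \<beta> at once; \<open>convL2\<close> is the sequential case.\<close>

definition tendsL2 :: "'e measure \<Rightarrow> ('i \<Rightarrow> 'e \<Rightarrow> real) \<Rightarrow> ('e \<Rightarrow> real) \<Rightarrow> 'i filter \<Rightarrow> bool" where
  "tendsL2 M F g net \<longleftrightarrow> ((\<lambda>t. nrmL2 M (\<lambda>x. F t x - g x)) \<longlongrightarrow> 0) net"

lemma convL2_iff_tendsL2: "convL2 M a f \<longleftrightarrow> tendsL2 M a f sequentially"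
  by (simp add: convL2_def tendsL2_def)

lemma tendsL2_bound:
  assumes "eventually (\<lambda>t. nrmL2 M (\<lambda>x. F t x - f x) \<le> b t) net" "(b \<longlongrightarrow> 0) net"
  shows "tendsL2 M F f net"
  unfolding tendsL2_def
  by (rule tendsto_sandwich[OF _ assms(1) tendsto_const assms(2)]) simp

lemma tendsL2_const: "tendsL2 M (\<lambda>_. f) f net"
  by (simp add: tendsL2_def nrmL2_def)

lemma tendsL2_ipL2:
  assumes F: "tendsL2 M F f net" "eventually (\<lambda>t. F t \<in> L2 M) net" "f \<in> L2 M"
    and G: "tendsL2 M G g net" "eventually (\<lambda>t. G t \<in> L2 M) net" "g \<in> L2 M"
  shows "((\<lambda>t. ipL2 M (F t) (G t)) \<longlongrightarrow> ipL2 M f g) net"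
proof -
  define a where "a t = nrmL2 M (\<lambda>x. F t x - f x)" for t
  define b where "b t = nrmL2 M (\<lambda>x. G t x - g x)" for t
  have lim: "(a \<longlongrightarrow> 0) net" "(b \<longlongrightarrow> 0) net"
    using F(1) G(1) unfolding a_def b_def tendsL2_def by auto
  have "((\<lambda>t. a t * b t + a t * nrmL2 M g + nrmL2 M f * b t) \<longlongrightarrow> 0 * 0 + 0 * nrmL2 M g + nrmL2 M f * 0) net"
    by (intro tendsto_intros lim)
  then have lim0: "((\<lambda>t. a t * b t + a t * nrmL2 M g + nrmL2 M f * b t) \<longlongrightarrow> 0) net" by simp
  have ev: "eventually (\<lambda>t. norm (ipL2 M (F t) (G t) - ipL2 M f g)
      \<le> a t * b t + a t * nrmL2 M g + nrmL2 M f * b t) net"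
    using F(2) G(2)
  proof eventually_elim
    case (elim t)
    have "ipL2 M (F t) (G t) - ipL2 M f g = ipL2 M (\<lambda>x. F t x - f x) (\<lambda>x. G t x - g x)
      + ipL2 M (\<lambda>x. F t x - f x) g + ipL2 M f (\<lambda>x. G t x - g x)"
      using elim F(3) G(3) by (simp add: ipL2_linear)
    also have "\<bar>\<dots>\<bar> \<le> a t * b t + a t * nrmL2 M g + nrmL2 M f * b t"
      unfolding a_def b_def using elim F(3) G(3)
      by (intro order_trans[OF abs_triangle_ineq] add_mono ipL2_Cauchy_Schwarz) auto
    finally show ?case by simp
  qed
  from Lim_null_comparison[OF ev lim0] show ?thesis by (simp add: LIM_zero_iff)
qed

lemma tendsL2_ipL2_left:
  assumes "tendsL2 M F f net" "eventually (\<lambda>t. F t \<in> L2 M) net" "f \<in> L2 M" "g \<in> L2 M"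
  shows "((\<lambda>t. ipL2 M (F t) g) \<longlongrightarrow> ipL2 M f g) net"
  using assms by (intro tendsL2_ipL2) (auto simp: tendsL2_const)

lemma tendsL2_ipL2_right:
  assumes "tendsL2 M F f net" "eventually (\<lambda>t. F t \<in> L2 M) net" "f \<in> L2 M" "g \<in> L2 M"
  shows "((\<lambda>t. ipL2 M g (F t)) \<longlongrightarrow> ipL2 M g f) net"
  using assms by (intro tendsL2_ipL2) (auto simp: tendsL2_const)

lemma tendsL2_lincomb:
  assumes F: "tendsL2 M F f net" "eventually (\<lambda>t. F t \<in> L2 M) net" "f \<in> L2 M"
    and G: "tendsL2 M G g net" "eventually (\<lambda>t. G t \<in> L2 M) net" "g \<in> L2 M"
  shows "tendsL2 M (\<lambda>t x. a * F t x + b * G t x) (\<lambda>x. a * f x + b * g x) net"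
proof (rule tendsL2_bound)
  show "eventually (\<lambda>t. nrmL2 M (\<lambda>x. (a * F t x + b * G t x) - (a * f x + b * g x))
     \<le> \<bar>a\<bar> * nrmL2 M (\<lambda>x. F t x - f x) + \<bar>b\<bar> * nrmL2 M (\<lambda>x. G t x - g x)) net"
    using F(2) G(2)
  proof eventually_elim
    case (elim t)
    have "nrmL2 M (\<lambda>x. a * (F t x - f x) + b * (G t x - g x))
      \<le> nrmL2 M (\<lambda>x. a * (F t x - f x)) + nrmL2 M (\<lambda>x. b * (G t x - g x))"
      using elim F(3) G(3) by (intro nrmL2_triangle) auto
    also have "\<dots> = \<bar>a\<bar> * nrmL2 M (\<lambda>x. F t x - f x) + \<bar>b\<bar> * nrmL2 M (\<lambda>x. G t x - g x)"
      by (simp add: nrmL2_scale)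
    also have "(\<lambda>x. a * (F t x - f x) + b * (G t x - g x)) = (\<lambda>x. (a * F t x + b * G t x) - (a * f x + b * g x))"
      by (auto simp: algebra_simps)
    finally show ?case .
  qed
  have "((\<lambda>t. \<bar>a\<bar> * nrmL2 M (\<lambda>x. F t x - f x) + \<bar>b\<bar> * nrmL2 M (\<lambda>x. G t x - g x))
      \<longlongrightarrow> \<bar>a\<bar> * 0 + \<bar>b\<bar> * 0) net"
    using F(1) G(1) unfolding tendsL2_def by (intro tendsto_intros)
  then show "((\<lambda>t. \<bar>a\<bar> * nrmL2 M (\<lambda>x. F t x - f x) + \<bar>b\<bar> * nrmL2 M (\<lambda>x. G t x - g x)) \<longlongrightarrow> 0) net"
    by simp
qed

lemma tendsL2_cong_AE:
  assumes "tendsL2 M F f net" "eventually (\<lambda>t. F t \<in> L2 M \<and> G t \<in> L2 M \<and> eqL2 M (F t) (G t)) net" "f \<in> L2 M"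
  shows "tendsL2 M G f net"
proof -
  have "eventually (\<lambda>t. nrmL2 M (\<lambda>x. F t x - f x) = nrmL2 M (\<lambda>x. G t x - f x)) net"
    using assms(2)
  proof eventually_elim
    case (elim t)
    then have "eqL2 M (\<lambda>x. F t x - f x) (\<lambda>x. G t x - f x)"
      by (auto elim: eqL2_imp)
    then show ?case using elim assms(3) by (intro nrmL2_cong) auto
  qed
  from tendsto_cong[OF this] assms(1) show ?thesis by (simp add: tendsL2_def)
qed

lemma tendsL2_unique:
  assumes "tendsL2 M F f net" "tendsL2 M F g net" "eventually (\<lambda>t. F t \<in> L2 M) net"
    "f \<in> L2 M" "g \<in> L2 M" "net \<noteq> bot"
  shows "eqL2 M f g"
proof (rule eqL2_if_ipL2_eq[OF assms(4,5)])
  fix h assume "h \<in> L2 M"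
  then show "ipL2 M f h = ipL2 M g h"
    using tendsto_unique[OF assms(6) tendsL2_ipL2_left tendsL2_ipL2_left] assms by blast
qed

section \<open>Completeness and orthogonal projection\<close>

lemma (in prob_space) nn_integral_abs_le_nrmL2:
  assumes "f \<in> L2 M"
  shows "(\<integral>\<^sup>+x. ennreal \<bar>f x\<bar> \<partial>M) \<le> ennreal (nrmL2 M f)"
proof -
  have one: "(\<lambda>_. 1) \<in> L2 M" by (simp add: L2_def)
  have abs: "(\<lambda>x. \<bar>f x\<bar>) \<in> L2 M" using assms by (auto simp: L2_def)
  have int: "integrable M (\<lambda>x. \<bar>f x\<bar>)" using L2_integrable_mult[OF abs one] by simp
  have "(\<integral>x. \<bar>f x\<bar> \<partial>M) \<le> nrmL2 M f"
    using ipL2_Cauchy_Schwarz[OF abs one] by (simp add: ipL2_def nrmL2_def prob_space)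
  then show ?thesis
    by (subst nn_integral_eq_integral[OF int]) (auto intro: ennreal_leI)
qed

lemma nn_integral_sq_eq_nrmL2:
  assumes "f \<in> L2 M"
  shows "(\<integral>\<^sup>+x. ennreal ((f x)\<^sup>2) \<partial>M) = ennreal ((nrmL2 M f)\<^sup>2)"
  using assms by (subst nn_integral_eq_integral) (auto simp: L2_def nrmL2_def)

text \<open>Riesz-Fischer. Along a subsequence whose increments have norm at most (1/2)^k the
  telescoping series converges absolutely almost everywhere, since on a probability space the L1
  norm is at most the L2 norm. Fatou's lemma then turns the Cauchy estimates into estimates against
  the pointwise limit.\<close>

lemma (in prob_space) L2_complete:
  assumes X: "\<And>n. X n \<in> L2 M"
    and Cauchy: "\<And>e. e > 0 \<Longrightarrow> \<exists>N. \<forall>m\<ge>N. \<forall>n\<ge>N. nrmL2 M (\<lambda>x. X m x - X n x) < e"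
  shows "\<exists>f\<in>L2 M. tendsL2 M X f sequentially"
proof -
  have "\<forall>k. \<exists>N. \<forall>m\<ge>N. \<forall>n\<ge>N. nrmL2 M (\<lambda>x. X m x - X n x) < (1/2)^k"
    using Cauchy by simp
  then obtain N where N: "\<And>k m n. m \<ge> N k \<Longrightarrow> n \<ge> N k \<Longrightarrow> nrmL2 M (\<lambda>x. X m x - X n x) < (1/2)^k"
    by metis
  \<comment> \<open>The partial sums make \<open>r\<close> monotone and at least \<open>N k\<close>,
    the summand \<open>k\<close> makes it unbounded; no recursive choice of a subsequence is
    needed.\<close>
  define r where "r k = k + (\<Sum>i\<le>k. N i)" for k
  have rN: "r k \<ge> N k" for k
    unfolding r_def using member_le_sum[of k "{..k}" N] by simp
  have rSuc: "r k \<le> r (Suc k)" for k by (simp add: r_def)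
  have rk: "k \<le> r k" for k by (simp add: r_def)
  define d where "d k x = X (r (Suc k)) x - X (r k) x" for k x
  have dL2: "d k \<in> L2 M" for k unfolding d_def using X by auto
  have dn: "nrmL2 M (d k) \<le> (1/2)^k" for k
    unfolding d_def using N[of k "r (Suc k)" "r k"] rN[of k] rSuc[of k] by simp
  have [measurable]: "X k \<in> borel_measurable M" "d k \<in> borel_measurable M" for k
    using X dL2 by (auto intro: L2_measurable)
  have "(\<integral>\<^sup>+x. (\<Sum>k. ennreal \<bar>d k x\<bar>) \<partial>M) = (\<Sum>k. \<integral>\<^sup>+x. ennreal \<bar>d k x\<bar> \<partial>M)"
    by (rule nn_integral_suminf) measurable
  also have "\<dots> \<le> (\<Sum>k. ennreal ((1/2)^k))"
    by (intro suminf_le order_trans[OF nn_integral_abs_le_nrmL2[OF dL2]] ennreal_leI dn) auto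
  also have "\<dots> < \<infinity>"
    by (subst suminf_ennreal2) (auto intro: summable_geometric)
  finally have "AE x in M. (\<Sum>k. ennreal \<bar>d k x\<bar>) \<noteq> \<infinity>"
    by (intro nn_integral_noteq_infinite) auto
  then have AE: "AE x in M. convergent (\<lambda>k. X (r k) x)"
  proof eventually_elim
    case (elim x)
    then have "summable (\<lambda>k. \<bar>d k x\<bar>)"
      by (intro summable_suminf_not_top) auto
    then have "summable (\<lambda>k. d k x)" by (rule summable_rabs_cancel)
    then have "convergent (\<lambda>n. \<Sum>k<n. d k x)" by (simp add: summable_iff_convergent)
    moreover have "(\<Sum>k<n. d k x) = X (r n) x - X (r 0) x" for n
      unfolding d_def by (rule sum_lessThan_telescope)
    ultimately have "convergent (\<lambda>n. X (r n) x - X (r 0) x)" by simp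
    then show ?case by (simp add: convergent_diff_const_right_iff)
  qed
  define f where "f x = lim (\<lambda>k. X (r k) x)" for x
  have f[measurable]: "f \<in> borel_measurable M"
    unfolding f_def by measurable
  have bound: "(\<integral>\<^sup>+x. ennreal ((X n x - f x)\<^sup>2) \<partial>M) \<le> ennreal (e\<^sup>2)"
    if e: "e \<ge> 0" and n: "\<And>k. k \<ge> m \<Longrightarrow> nrmL2 M (\<lambda>x. X n x - X (r k) x) \<le> e" for n m e
  proof -
    have "(\<integral>\<^sup>+x. ennreal ((X n x - f x)\<^sup>2) \<partial>M)
        = (\<integral>\<^sup>+x. liminf (\<lambda>k. ennreal ((X n x - X (r k) x)\<^sup>2)) \<partial>M)"
    proof (rule nn_integral_cong_AE, use AE in eventually_elim)
      case (elim x)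
      then have "(\<lambda>k. X (r k) x) \<longlonglongrightarrow> f x" unfolding f_def by (simp add: convergent_LIMSEQ_iff)
      then have "(\<lambda>k. ennreal ((X n x - X (r k) x)\<^sup>2)) \<longlonglongrightarrow> ennreal ((X n x - f x)\<^sup>2)"
        by (intro tendsto_intros)
      from lim_imp_Liminf[OF _ this] show ?case by simp
    qed
    also have "\<dots> \<le> liminf (\<lambda>k. \<integral>\<^sup>+x. ennreal ((X n x - X (r k) x)\<^sup>2) \<partial>M)"
      by (rule nn_integral_liminf) measurable
    also have "\<dots> \<le> ennreal (e\<^sup>2)"
    proof (rule Liminf_le)
      show "eventually (\<lambda>k. (\<integral>\<^sup>+x. ennreal ((X n x - X (r k) x)\<^sup>2) \<partial>M) \<le> ennreal (e\<^sup>2)) sequentially"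
        using eventually_ge_at_top[of m]
      proof eventually_elim
        case (elim k)
        show ?case
          using n[OF elim] X by (subst nn_integral_sq_eq_nrmL2) (auto intro!: ennreal_leI power_mono)
      qed
    qed simp
    finally show ?thesis .
  qed
  have diff: "(\<lambda>x. X n x - f x) \<in> L2 M \<and> nrmL2 M (\<lambda>x. X n x - f x) \<le> e"
    if e: "e \<ge> 0" and n: "\<And>k. k \<ge> m \<Longrightarrow> nrmL2 M (\<lambda>x. X n x - X (r k) x) \<le> e" for n m e
  proof -
    note b = bound[OF e n]
    have "integrable M (\<lambda>x. (X n x - f x)\<^sup>2)"
      using le_less_trans[OF b] by (intro integrableI_bounded) auto
    then have L: "(\<lambda>x. X n x - f x) \<in> L2 M" by (simp add: L2_def)
    have "(nrmL2 M (\<lambda>x. X n x - f x))\<^sup>2 \<le> e\<^sup>2"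
      using b unfolding nn_integral_sq_eq_nrmL2[OF L] by simp
    then show ?thesis using L e by (auto intro: power2_le_imp_le)
  qed
  have diffN: "(\<lambda>x. X n x - f x) \<in> L2 M \<and> nrmL2 M (\<lambda>x. X n x - f x) \<le> (1/2)^k" if "n \<ge> N k" for n k
    using that N[of k] rk order_trans[OF _ rk] by (intro diff[of _ "N k"]) (auto intro: less_imp_le)
  \<comment> \<open>\<open>f\<close> is recovered as \<open>X (N 0)\<close> minus a square
    integrable remainder.\<close>
  have "f \<in> L2 M"
    using L2_diff[OF X[of "N 0"], of "\<lambda>x. X (N 0) x - f x"] diffN[of 0 "N 0"] by simp
  moreover have "tendsL2 M X f sequentially"
    unfolding tendsL2_def
  proof (rule LIMSEQ_I)
    fix e :: real assume "e > 0"
    then obtain k where k: "(1/2)^k < e" using real_arch_pow_inv[of e "1/2"] by auto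
    then show "\<exists>no. \<forall>n\<ge>no. norm (nrmL2 M (\<lambda>x. X n x - f x) - 0) < e"
      using diffN[of k] by (intro exI[of _ "N k"]) force
  qed
  ultimately show ?thesis by blast
qed

text \<open>A minimising sequence in \<open>V\<close> is Cauchy, and the residual of its limit is
  orthogonal to \<open>V\<close>, hence null. \<open>V\<close> may fail to be closed: the limit is
  only sought in L2.\<close>

lemma (in prob_space) orthogonal_trivial_imp_dense:
  assumes V: "V \<subseteq> L2 M" "V \<noteq> {}"
    and lin: "\<And>u v a b. u \<in> V \<Longrightarrow> v \<in> V \<Longrightarrow> (\<lambda>x. a * u x + b * v x) \<in> V"
    and orth: "\<And>h. h \<in> L2 M \<Longrightarrow> (\<And>v. v \<in> V \<Longrightarrow> ipL2 M v h = 0) \<Longrightarrow> nrmL2 M h = 0"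
    and f: "f \<in> L2 M"
  shows "\<exists>v. (\<forall>n. v n \<in> V) \<and> tendsL2 M v f sequentially"
proof -
  define dd where "dd v = ipL2 M (\<lambda>x. f x - v x) (\<lambda>x. f x - v x)" for v
  define d where "d = Inf (dd ` V)"
  have dd0: "0 \<le> dd v" for v by (simp add: dd_def ipL2_nonneg)
  have bdd: "bdd_below (dd ` V)" using dd0 by (intro bdd_belowI2[of _ 0])
  have dle: "d \<le> dd v" if "v \<in> V" for v
    unfolding d_def using that by (intro cInf_lower bdd) auto
  define \<epsilon> where "\<epsilon> n = inverse (real (Suc n))" for n
  have \<epsilon>_pos: "\<epsilon> n > 0" for n by (simp add: \<epsilon>_def)
  have "\<exists>v\<in>V. dd v < d + \<epsilon> n" for n
    using cInf_lessD[of "dd ` V" "d + \<epsilon> n"] V(2) \<epsilon>_pos[of n] by (auto simp: d_def)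
  then obtain v where v: "\<And>n. v n \<in> V" "\<And>n. dd (v n) < d + \<epsilon> n" by metis
  have vL2: "v n \<in> L2 M" for n using v V by auto
  have par: "(nrmL2 M (\<lambda>x. v m x - v n x))\<^sup>2 \<le> 2 * \<epsilon> m + 2 * \<epsilon> n" for m n
  proof -
    \<comment> \<open>Parallelogram identity: the midpoint lies in \<open>V\<close>, so its squared
      distance to \<open>f\<close> is at least \<open>d\<close>, which forces the two
      near-minimisers together.\<close>
    define w where "w = (\<lambda>x. (1/2) * v m x + (1/2) * v n x)"
    have "w \<in> V" unfolding w_def by (intro lin v)
    then have mid: "d \<le> dd w" by (rule dle)
    have "(nrmL2 M (\<lambda>x. v m x - v n x))\<^sup>2
       = 2 * dd (v m) + 2 * dd (v n) - 4 * dd w"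
      using f vL2 by (simp add: w_def nrmL2_sq dd_def ipL2_linear ipL2_commute[of M "v m" f]
          ipL2_commute[of M "v n" f] ipL2_commute[of M "v n" "v m"] algebra_simps
          add_divide_distrib diff_divide_distrib)
    also have "\<dots> \<le> 2 * \<epsilon> m + 2 * \<epsilon> n"
      using v(2)[of m] v(2)[of n] mid by simp
    finally show ?thesis .
  qed
  have "\<exists>N. \<forall>m\<ge>N. \<forall>n\<ge>N. nrmL2 M (\<lambda>x. v m x - v n x) < e" if e: "e > 0" for e
  proof -
    obtain N where N: "\<epsilon> N < e\<^sup>2 / 4"
      using reals_Archimedean[of "e\<^sup>2 / 4"] e by (auto simp: \<epsilon>_def)
    have "nrmL2 M (\<lambda>x. v m x - v n x) < e" if "m \<ge> N" "n \<ge> N" for m n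
    proof -
      have "\<epsilon> k < e\<^sup>2 / 4" if "k \<ge> N" for k
        by (rule le_less_trans[OF _ N]) (use that in \<open>simp add: \<epsilon>_def\<close>)
      from this[of m] this[of n] par[of m n] that
      have "(nrmL2 M (\<lambda>x. v m x - v n x))\<^sup>2 < e\<^sup>2" by simp
      then show ?thesis using e by (auto intro: power_less_imp_less_base)
    qed
    then show ?thesis by blast
  qed
  from L2_complete[of v, OF vL2 this]
  obtain p where p: "p \<in> L2 M" "tendsL2 M v p sequentially" by auto
  have fp: "(\<lambda>x. f x - p x) \<in> L2 M" using f p by auto
  have "ipL2 M w (\<lambda>x. f x - p x) = 0" if w: "w \<in> V" for w
  proof -
    have wL: "w \<in> L2 M" using w V by auto
    \<comment> \<open>\<open>v n\<close> is minimal only up to \<open>\<epsilon> n\<close>.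
      Perturbing it by \<open>t * w\<close> gives a quadratic in \<open>t\<close> with that constant
      term, and its discriminant bounds the pairing with \<open>w\<close>.\<close>
    have ineq: "0 \<le> \<epsilon> n + 2 * t * (- ipL2 M (\<lambda>x. f x - v n x) w) + t\<^sup>2 * ipL2 M w w" for n t
    proof -
      have "d \<le> dd (\<lambda>x. 1 * v n x + t * w x)" by (intro dle lin v w)
      also have "\<dots> = dd (v n) + 2 * t * (- ipL2 M (\<lambda>x. f x - v n x) w) + t\<^sup>2 * ipL2 M w w"
        using f vL2 wL by (simp add: dd_def ipL2_linear ipL2_commute[of M w f]
            ipL2_commute[of M w "v n"] ipL2_commute[of M "v n" f]
            power2_eq_square algebra_simps)
      finally show ?thesis using v(2)[of n] by linarith
    qed
    have "(ipL2 M (\<lambda>x. f x - v n x) w)\<^sup>2 \<le> \<epsilon> n * ipL2 M w w" for n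
      using nonneg_form_Cauchy_Schwarz[OF ineq ipL2_nonneg] by simp
    moreover have "(\<lambda>n. \<epsilon> n * ipL2 M w w) \<longlonglongrightarrow> 0 * ipL2 M w w"
      unfolding \<epsilon>_def by (intro tendsto_mult tendsto_const LIMSEQ_inverse_real_of_nat)
    moreover have "(\<lambda>n. (ipL2 M (\<lambda>x. f x - v n x) w)\<^sup>2) \<longlonglongrightarrow> (ipL2 M (\<lambda>x. f x - p x) w)\<^sup>2"
      using tendsL2_ipL2_left[OF p(2) _ p(1) wL] f vL2 wL p(1)
      by (intro tendsto_power) (auto simp: ipL2_linear intro!: tendsto_intros)
    ultimately have "(ipL2 M (\<lambda>x. f x - p x) w)\<^sup>2 \<le> 0 * ipL2 M w w"
      by (intro LIMSEQ_le) auto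
    then show ?thesis by (simp add: ipL2_commute[of M w "\<lambda>x. f x - p x"])
  qed
  then have "nrmL2 M (\<lambda>x. f x - p x) = 0" by (intro orth fp) auto
  then have "nrmL2 M (\<lambda>x. p x - f x) = 0" by (simp add: nrmL2_minus_commute[of M p f])
  then have "nrmL2 M (\<lambda>x. v n x - f x) \<le> nrmL2 M (\<lambda>x. v n x - p x)" for n
    using nrmL2_triangle3[OF vL2[of n] p(1) f] by simp
  then have "tendsL2 M v f sequentially"
    using p(2) unfolding tendsL2_def[of M v p] by (intro tendsL2_bound) auto
  then show ?thesis using v by blast
qed

section \<open>Contraction semigroups\<close>

lemma integral_exp_minus_Ici:
  fixes lam :: real
  assumes "lam > 0"
  shows "set_integrable lborel {0..} (\<lambda>t. exp (- lam * t))"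
    and "(LBINT t:{0..}. exp (- lam * t)) = 1 / lam"
proof -
  have hi: "((\<lambda>t. exp (- lam * t)) has_integral 1 / lam) {0..}"
    using has_integral_exp_minus_to_infinity[OF assms, of 0] by simp
  have "(\<integral>\<^sup>+t. ennreal (indicator {0..} t * exp (- lam * t)) \<partial>lborel) = ennreal (1 / lam)"
  proof (rule nn_integral_has_integral_lborel)
    have "(\<lambda>t. indicator {0..} t * exp (- lam * t)) = (\<lambda>t. if t \<in> {0..} then exp (- lam * t) else 0)"
      by auto
    then show "((\<lambda>t. indicator {0..} t * exp (- lam * t)) has_integral 1 / lam) UNIV"
      using hi by (simp only: has_integral_restrict_UNIV)
  qed auto
  then have "has_bochner_integral lborel (\<lambda>t. indicator {0..} t * exp (- lam * t)) (1 / lam)"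
    using assms by (intro has_bochner_integral_nn_integral) auto
  then show "set_integrable lborel {0..} (\<lambda>t. exp (- lam * t))"
    and "(LBINT t:{0..}. exp (- lam * t)) = 1 / lam"
    by (auto simp: set_integrable_def set_lebesgue_integral_def has_bochner_integral_iff)
qed

text \<open>Lets right continuity at 0 be used at every \<open>t\<close> and from both sides, with
  the distance of the two times as the time step.\<close>

lemma filterlim_abs_diff: "filterlim (\<lambda>s. \<bar>s - t\<bar>) (at_right 0) (at (t::real) within S)"
proof -
  have "((\<lambda>s. \<bar>s - t\<bar>) \<longlongrightarrow> \<bar>t - t\<bar>) (at t within S)" by (intro tendsto_intros)
  then show ?thesis
    by (auto simp: filterlim_at eventually_at_filter)
qed

locale contraction_sg = prob_space M for M :: "'e measure" +
  fixes P :: "real \<Rightarrow> ('e \<Rightarrow> real) \<Rightarrow> ('e \<Rightarrow> real)"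
  assumes sg: "sc_contraction_semigroup M P"
begin

lemma P_L2 [simp, intro]: "t \<ge> 0 \<Longrightarrow> f \<in> L2 M \<Longrightarrow> P t f \<in> L2 M"
  using sg by (auto simp: sc_contraction_semigroup_def sc_semigroup_def L2_op_def)

lemma P_cong: "t \<ge> 0 \<Longrightarrow> f \<in> L2 M \<Longrightarrow> g \<in> L2 M \<Longrightarrow> eqL2 M f g \<Longrightarrow> eqL2 M (P t f) (P t g)"
  using sg by (auto simp: sc_contraction_semigroup_def sc_semigroup_def L2_op_def)

lemma P_lincomb:
  "t \<ge> 0 \<Longrightarrow> f \<in> L2 M \<Longrightarrow> g \<in> L2 M \<Longrightarrow>
    eqL2 M (P t (\<lambda>x. a * f x + b * g x)) (\<lambda>x. a * P t f x + b * P t g x)"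
  using sg by (auto simp: sc_contraction_semigroup_def sc_semigroup_def L2_op_def)

lemma P_diff:
  "t \<ge> 0 \<Longrightarrow> f \<in> L2 M \<Longrightarrow> g \<in> L2 M \<Longrightarrow> eqL2 M (P t (\<lambda>x. f x - g x)) (\<lambda>x. P t f x - P t g x)"
  using P_lincomb[of t f g 1 "-1"] by simp

lemma P_contraction: "t \<ge> 0 \<Longrightarrow> f \<in> L2 M \<Longrightarrow> nrmL2 M (P t f) \<le> nrmL2 M f"
  using sg by (auto simp: sc_contraction_semigroup_def)

lemma P_zero: "f \<in> L2 M \<Longrightarrow> eqL2 M (P 0 f) f"
  using sg by (auto simp: sc_contraction_semigroup_def sc_semigroup_def)

lemma P_add: "s \<ge> 0 \<Longrightarrow> t \<ge> 0 \<Longrightarrow> f \<in> L2 M \<Longrightarrow> eqL2 M (P (s + t) f) (P s (P t f))"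
  using sg by (auto simp: sc_contraction_semigroup_def sc_semigroup_def)

lemma P_continuous_0: "f \<in> L2 M \<Longrightarrow> tendsL2 M (\<lambda>t. P t f) f (at_right 0)"
  using sg by (auto simp: sc_contraction_semigroup_def sc_semigroup_def tendsL2_def)

lemma P_contraction_diff:
  assumes "t \<ge> 0" "f \<in> L2 M" "g \<in> L2 M"
  shows "nrmL2 M (\<lambda>x. P t f x - P t g x) \<le> nrmL2 M (\<lambda>x. f x - g x)"
  using P_contraction[of t "\<lambda>x. f x - g x"] nrmL2_cong[OF P_diff[OF assms]] assms by simp

lemma ipL2_P_bound:
  assumes "t \<ge> 0" "f \<in> L2 M" "g \<in> L2 M"
  shows "\<bar>ipL2 M (P t f) g\<bar> \<le> nrmL2 M f * nrmL2 M g"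
  using ipL2_Cauchy_Schwarz[of "P t f" M g] P_contraction[of t f] assms
  by (meson P_L2 mult_right_mono nrmL2_nonneg order_trans)

lemma P_increment:
  assumes "s \<ge> 0" "h \<ge> 0" "f \<in> L2 M"
  shows "eqL2 M (\<lambda>x. P (s + h) f x - P s f x) (P s (\<lambda>x. P h f x - f x))"
  using assms by (intro eqL2_imp2[OF P_add[OF assms] P_diff[of s "P h f" f]]) auto

text \<open>Factor out the semigroup at the smaller time: the remaining increment starts at 0, and
  contraction removes the factor.\<close>

lemma P_modulus:
  assumes "s \<ge> 0" "t \<ge> 0" "f \<in> L2 M"
  shows "nrmL2 M (\<lambda>x. P s f x - P t f x) \<le> nrmL2 M (\<lambda>x. P \<bar>s - t\<bar> f x - f x)"
proof -
  have *: "nrmL2 M (\<lambda>x. P b f x - P a f x) \<le> nrmL2 M (\<lambda>x. P (b - a) f x - f x)"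
    if "0 \<le> a" "a \<le> b" for a b
  proof -
    have "nrmL2 M (\<lambda>x. P b f x - P a f x) = nrmL2 M (P a (\<lambda>x. P (b - a) f x - f x))"
      using P_increment[of a "b - a" f] that assms by (intro nrmL2_cong) auto
    also have "\<dots> \<le> nrmL2 M (\<lambda>x. P (b - a) f x - f x)"
      using that assms by (intro P_contraction) auto
    finally show ?thesis .
  qed
  show ?thesis
  proof (cases "t \<le> s")
    case True then show ?thesis using *[of t s] assms by simp
  next
    case False then show ?thesis using *[of s t] assms by (simp add: nrmL2_minus_commute[of M "P s f"])
  qed
qed

lemma P_continuous:
  assumes "t \<ge> 0" "f \<in> L2 M"
  shows "tendsL2 M (\<lambda>s. P s f) (P t f) (at t within {0..})"
proof (rule tendsL2_bound)
  show "eventually (\<lambda>s. nrmL2 M (\<lambda>x. P s f x - P t f x) \<le> nrmL2 M (\<lambda>x. P \<bar>s - t\<bar> f x - f x)) (at t within {0..})"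
    using assms by (auto simp: eventually_at_filter intro!: always_eventually P_modulus)
  show "((\<lambda>s. nrmL2 M (\<lambda>x. P \<bar>s - t\<bar> f x - f x)) \<longlongrightarrow> 0) (at t within {0..})"
    using filterlim_compose[OF P_continuous_0[OF assms(2), unfolded tendsL2_def] filterlim_abs_diff] .
qed

lemma ipL2_P_continuous_on:
  assumes "f \<in> L2 M" "g \<in> L2 M"
  shows "continuous_on {0..} (\<lambda>t. ipL2 M (P t f) g)"
  unfolding continuous_on_def using assms
  by (auto intro!: tendsL2_ipL2_left P_continuous simp: eventually_at_filter)

section \<open>The generator: linearity, dissipativity, commutation with the semigroup\<close>

lemma gen_props:
  assumes "f \<in> gen_dom M P"
  shows "f \<in> L2 M" "gen M P f \<in> L2 M" "tendsL2 M (\<lambda>t x. (P t f x - f x) / t) (gen M P f) (at_right 0)"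
proof -
  have "\<exists>g. g \<in> L2 M \<and> ((\<lambda>t. nrmL2 M (\<lambda>x. (P t f x - f x) / t - g x)) \<longlongrightarrow> 0) (at_right 0)"
    using assms by (auto simp: gen_dom_def)
  from someI_ex[OF this] show "gen M P f \<in> L2 M" "tendsL2 M (\<lambda>t x. (P t f x - f x) / t) (gen M P f) (at_right 0)"
    unfolding gen_def tendsL2_def by auto
  show "f \<in> L2 M" using assms by (simp add: gen_dom_def)
qed

lemma quotient_L2: "f \<in> L2 M \<Longrightarrow> eventually (\<lambda>t. (\<lambda>x. (P t f x - f x) / t) \<in> L2 M) (at_right 0)"
  by (auto simp: eventually_at_filter)

lemma gen_eqI:
  assumes "f \<in> L2 M" "g \<in> L2 M" "tendsL2 M (\<lambda>t x. (P t f x - f x) / t) g (at_right 0)"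
  shows "f \<in> gen_dom M P" "eqL2 M (gen M P f) g"
proof -
  show *: "f \<in> gen_dom M P" using assms by (auto simp: gen_dom_def tendsL2_def)
  show "eqL2 M (gen M P f) g"
    using gen_props[OF *] assms quotient_L2[OF assms(1)] by (intro tendsL2_unique) auto
qed

lemma gen_lincomb:
  assumes "f \<in> gen_dom M P" "g \<in> gen_dom M P"
  shows "(\<lambda>x. a * f x + b * g x) \<in> gen_dom M P"
    "eqL2 M (gen M P (\<lambda>x. a * f x + b * g x)) (\<lambda>x. a * gen M P f x + b * gen M P g x)"
proof -
  note f = gen_props[OF assms(1)] and g = gen_props[OF assms(2)]
  have "tendsL2 M (\<lambda>t x. a * ((P t f x - f x) / t) + b * ((P t g x - g x) / t))
      (\<lambda>x. a * gen M P f x + b * gen M P g x) (at_right 0)"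
    using f g by (intro tendsL2_lincomb quotient_L2) auto
  then have "tendsL2 M (\<lambda>t x. (P t (\<lambda>x. a * f x + b * g x) x - (a * f x + b * g x)) / t)
      (\<lambda>x. a * gen M P f x + b * gen M P g x) (at_right 0)"
  proof (rule tendsL2_cong_AE)
    show "eventually (\<lambda>t. (\<lambda>x. a * ((P t f x - f x) / t) + b * ((P t g x - g x) / t)) \<in> L2 M \<and>
       (\<lambda>x. (P t (\<lambda>x. a * f x + b * g x) x - (a * f x + b * g x)) / t) \<in> L2 M \<and>
       eqL2 M (\<lambda>x. a * ((P t f x - f x) / t) + b * ((P t g x - g x) / t))
         (\<lambda>x. (P t (\<lambda>x. a * f x + b * g x) x - (a * f x + b * g x)) / t)) (at_right 0)"
      using eventually_at_right_less
    proof eventually_elim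
      case (elim t)
      then have "eqL2 M (\<lambda>x. a * ((P t f x - f x) / t) + b * ((P t g x - g x) / t))
         (\<lambda>x. (P t (\<lambda>x. a * f x + b * g x) x - (a * f x + b * g x)) / t)"
        using f(1) g(1) by (intro eqL2_imp[OF P_lincomb[of t f g a b]]) (auto simp: field_simps)
      then show ?case using elim f(1) g(1) by (auto intro!: L2_lincomb L2_divide L2_diff P_L2)
    qed
  qed (use f g in auto)
  from gen_eqI[OF _ _ this] f g show "(\<lambda>x. a * f x + b * g x) \<in> gen_dom M P"
    "eqL2 M (gen M P (\<lambda>x. a * f x + b * g x)) (\<lambda>x. a * gen M P f x + b * gen M P g x)" by auto
qed

text \<open>Literal equality holds because \<open>gen\<close> is a choice from a set that depends
  only on the class of its argument. It allows \<open>Q (Q g)\<close> to be replaced by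
  \<open>g\<close> under \<open>gen\<close>.\<close>

lemma gen_cong:
  assumes "f \<in> L2 M" "g \<in> L2 M" "eqL2 M f g"
  shows "gen M P f = gen M P g"
proof -
  have "((\<lambda>t. nrmL2 M (\<lambda>x. (P t f x - f x) / t - k x)) \<longlongrightarrow> 0) (at_right 0) \<longleftrightarrow>
        ((\<lambda>t. nrmL2 M (\<lambda>x. (P t g x - g x) / t - k x)) \<longlongrightarrow> 0) (at_right 0)" if k: "k \<in> L2 M" for k
  proof (rule tendsto_cong)
    show "eventually (\<lambda>t. nrmL2 M (\<lambda>x. (P t f x - f x) / t - k x) = nrmL2 M (\<lambda>x. (P t g x - g x) / t - k x)) (at_right 0)"
      using eventually_at_right_less
    proof eventually_elim
      case (elim t)
      then have "eqL2 M (\<lambda>x. (P t f x - f x) / t - k x) (\<lambda>x. (P t g x - g x) / t - k x)"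
        using assms elim by (intro eqL2_imp2[OF P_cong[OF _ assms(1,2,3)] assms(3)]) auto
      then show ?case using elim assms k by (intro nrmL2_cong) auto
    qed
  qed
  then show ?thesis unfolding gen_def by (intro arg_cong[of _ _ Eps]) auto
qed

text \<open>Contraction and Cauchy-Schwarz make every difference quotient paired with
  \<open>f\<close> nonpositive.\<close>

lemma gen_dissipative:
  assumes "f \<in> gen_dom M P"
  shows "ipL2 M f (gen M P f) \<le> 0"
proof -
  note f = gen_props[OF assms]
  have "((\<lambda>t. ipL2 M f (\<lambda>x. (P t f x - f x) / t)) \<longlongrightarrow> ipL2 M f (gen M P f)) (at_right 0)"
    using f quotient_L2 by (intro tendsL2_ipL2_right) auto
  moreover have "eventually (\<lambda>t. ipL2 M f (\<lambda>x. (P t f x - f x) / t) \<le> 0) (at_right 0)"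
    using eventually_at_right_less
  proof eventually_elim
    case (elim t)
    have "ipL2 M f (P t f) \<le> ipL2 M f f"
      using ipL2_P_bound[of t f f] f(1) elim nrmL2_sq[of M f]
      by (simp add: ipL2_commute[of M f "P t f"] power2_eq_square abs_le_iff)
    then show ?case using elim f(1) by (simp add: ipL2_linear divide_nonpos_pos)
  qed
  ultimately show ?thesis by (intro tendsto_upperbound) auto
qed

lemma gen_P_commute:
  assumes "f \<in> gen_dom M P" "t \<ge> 0"
  shows "P t f \<in> gen_dom M P" "eqL2 M (gen M P (P t f)) (P t (gen M P f))"
proof -
  note f = gen_props[OF assms(1)]
  have "tendsL2 M (\<lambda>h x. (P h (P t f) x - P t f x) / h) (P t (gen M P f)) (at_right 0)"
  proof (rule tendsL2_bound)
    show "eventually (\<lambda>h. nrmL2 M (\<lambda>x. (P h (P t f) x - P t f x) / h - P t (gen M P f) x)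
        \<le> nrmL2 M (\<lambda>x. (P h f x - f x) / h - gen M P f x)) (at_right 0)"
      using eventually_at_right_less
    proof eventually_elim
      case (elim h)
      have e1: "eqL2 M (P t (\<lambda>x. (P h f x - f x) / h)) (\<lambda>x. (P t (P h f) x - P t f x) / h)"
        using P_lincomb[of t "P h f" f "1 / h" "- (1 / h)"] elim assms(2) f(1)
        by (simp add: diff_divide_distrib)
      \<comment> \<open>The semigroup law is read for both \<open>h + t\<close> and
        \<open>t + h\<close>, so that \<open>P t\<close> can be pulled out of the quotient.\<close>
      have "eqL2 M (\<lambda>x. (P h (P t f) x - P t f x) / h - P t (gen M P f) x)
         (\<lambda>x. P t (\<lambda>x. (P h f x - f x) / h) x - P t (gen M P f) x)"
        using elim assms(2) f(1)
        by (intro eqL2_imp3[OF e1 P_add[of h t f] P_add[of t h f]]) (auto simp: add.commute)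
      then have "nrmL2 M (\<lambda>x. (P h (P t f) x - P t f x) / h - P t (gen M P f) x)
        = nrmL2 M (\<lambda>x. P t (\<lambda>x. (P h f x - f x) / h) x - P t (gen M P f) x)"
        using elim assms(2) f by (intro nrmL2_cong) auto
      also have "\<dots> \<le> nrmL2 M (\<lambda>x. (P h f x - f x) / h - gen M P f x)"
        using elim assms(2) f by (intro P_contraction_diff) auto
      finally show ?case .
    qed
  qed (use f(3) in \<open>simp add: tendsL2_def\<close>)
  from gen_eqI[OF _ _ this] f assms show "P t f \<in> gen_dom M P" "eqL2 M (gen M P (P t f)) (P t (gen M P f))"
    by auto
qed

text \<open>Both one-sided quotients are \<open>P a\<close> applied to a quotient at 0, with
  \<open>a\<close> the earlier time. For the left one \<open>a\<close> differs from
  \<open>t\<close>, so besides the error of the quotient the modulus of continuity of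
  \<open>P\<close> on \<open>gen M P f\<close> must be paid; the bound \<open>q\<close> contains
  both.\<close>

lemma ipL2_P_has_derivative:
  assumes f: "f \<in> gen_dom M P" and g: "g \<in> L2 M" and t: "t \<ge> 0"
  shows "((\<lambda>s. ipL2 M (P s f) g) has_real_derivative ipL2 M (P t (gen M P f)) g) (at t within {0..})"
proof -
  note fp = gen_props[OF f]
  let ?L = "gen M P f"
  define q where "q h = nrmL2 M (\<lambda>x. (P h f x - f x) / h - ?L x) + nrmL2 M (\<lambda>x. P h ?L x - ?L x)" for h
  have q0: "(q \<longlongrightarrow> 0) (at_right 0)"
    unfolding q_def using tendsto_add[OF fp(3)[unfolded tendsL2_def] P_continuous_0[OF fp(2), unfolded tendsL2_def]]
    by simp
  have key: "\<bar>(ipL2 M (P b f) g - ipL2 M (P a f) g) / (b - a) - ipL2 M (P t ?L) g\<bar> \<le> q (b - a) * nrmL2 M g"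
    if ab: "0 \<le> a" "a < b" "t = a \<or> t = b" for a b
  proof -
    let ?h = "b - a"
    have "ipL2 M (P b f) g - ipL2 M (P a f) g = ipL2 M (\<lambda>x. P b f x - P a f x) g"
      using ab fp g by (simp add: ipL2_linear)
    also have "\<dots> = ipL2 M (P a (\<lambda>x. P ?h f x - f x)) g"
      using P_increment[of a ?h f] ab fp g by (intro ipL2_cong_left) auto
    finally have "(ipL2 M (P b f) g - ipL2 M (P a f) g) / ?h = ipL2 M (\<lambda>x. P a (\<lambda>x. P ?h f x - f x) x / ?h) g"
      by (simp add: ipL2_linear)
    also have "\<dots> = ipL2 M (P a (\<lambda>x. (P ?h f x - f x) / ?h)) g"
      using P_lincomb[of a "\<lambda>x. P ?h f x - f x" "\<lambda>x. P ?h f x - f x" "1 / ?h" 0] ab fp g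
      by (intro ipL2_cong_left eqL2_sym[of M "P a _"]) auto
    finally have eq: "(ipL2 M (P b f) g - ipL2 M (P a f) g) / ?h = ipL2 M (P a (\<lambda>x. (P ?h f x - f x) / ?h)) g" .
    have "nrmL2 M (\<lambda>x. P a (\<lambda>x. (P ?h f x - f x) / ?h) x - P t ?L x)
      \<le> nrmL2 M (\<lambda>x. P a (\<lambda>x. (P ?h f x - f x) / ?h) x - P a ?L x) + nrmL2 M (\<lambda>x. P a ?L x - P t ?L x)"
      using ab fp t by (intro nrmL2_triangle3) auto
    also have "\<dots> \<le> q ?h"
      unfolding q_def
    proof (rule add_mono)
      show "nrmL2 M (\<lambda>x. P a (\<lambda>x. (P ?h f x - f x) / ?h) x - P a ?L x) \<le> nrmL2 M (\<lambda>x. (P ?h f x - f x) / ?h - ?L x)"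
        using ab fp by (intro P_contraction_diff) auto
      show "nrmL2 M (\<lambda>x. P a ?L x - P t ?L x) \<le> nrmL2 M (\<lambda>x. P ?h ?L x - ?L x)"
      proof (cases "t = a")
        case True
        then show ?thesis by (simp add: nrmL2_def[of M "\<lambda>x. 0"])
      next
        case False
        then have "\<bar>a - t\<bar> = ?h" using ab by auto
        then show ?thesis using P_modulus[of a t ?L] ab t fp by simp
      qed
    qed
    finally have n: "nrmL2 M (\<lambda>x. P a (\<lambda>x. (P ?h f x - f x) / ?h) x - P t ?L x) \<le> q ?h" .
    have "ipL2 M (P a (\<lambda>x. (P ?h f x - f x) / ?h)) g - ipL2 M (P t ?L) g
        = ipL2 M (\<lambda>x. P a (\<lambda>x. (P ?h f x - f x) / ?h) x - P t ?L x) g"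
      using ab fp g t by (subst ipL2_diff_left) auto
    also have "\<bar>\<dots>\<bar> \<le> q ?h * nrmL2 M g"
      using ab fp g t n by (intro order_trans[OF ipL2_Cauchy_Schwarz] mult_right_mono) auto
    finally show ?thesis unfolding eq .
  qed
  have "((\<lambda>s. (ipL2 M (P s f) g - ipL2 M (P t f) g) / (s - t) - ipL2 M (P t ?L) g) \<longlongrightarrow> 0) (at t within {0..})"
  proof (rule Lim_null_comparison)
    show "eventually (\<lambda>s. norm ((ipL2 M (P s f) g - ipL2 M (P t f) g) / (s - t) - ipL2 M (P t ?L) g)
        \<le> q \<bar>s - t\<bar> * nrmL2 M g) (at t within {0..})"
    proof (unfold eventually_at_filter, intro always_eventually allI impI)
      fix s assume s: "s \<noteq> t" "s \<in> {0..}"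
      show "norm ((ipL2 M (P s f) g - ipL2 M (P t f) g) / (s - t) - ipL2 M (P t ?L) g) \<le> q \<bar>s - t\<bar> * nrmL2 M g"
      proof (cases "s < t")
        case True
        have "(ipL2 M (P s f) g - ipL2 M (P t f) g) / (s - t) = (ipL2 M (P t f) g - ipL2 M (P s f) g) / (t - s)"
          using True by (simp add: field_simps)
        then show ?thesis using key[of s t] s True by simp
      next
        case False
        then show ?thesis using key[of t s] s t by simp
      qed
    qed
    have "((\<lambda>s. q \<bar>s - t\<bar> * nrmL2 M g) \<longlongrightarrow> 0 * nrmL2 M g) (at t within {0..})"
      by (intro tendsto_mult tendsto_const filterlim_compose[OF q0 filterlim_abs_diff])
    then show "((\<lambda>s. q \<bar>s - t\<bar> * nrmL2 M g) \<longlongrightarrow> 0) (at t within {0..})" by simp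
  qed
  then show ?thesis by (simp add: has_field_derivative_iff LIM_zero_iff)
qed

text \<open>The scalar that the resolvent must have as its pairing with \<open>g\<close>. It is
  estimated and evaluated before any vector representing it is known to exist.\<close>

definition laplace :: "real \<Rightarrow> ('e \<Rightarrow> real) \<Rightarrow> ('e \<Rightarrow> real) \<Rightarrow> real" where
  "laplace lam f g = (LBINT t:{0..}. exp (- lam * t) * ipL2 M (P t f) g)"

lemma laplace_integrable:
  assumes "lam > 0" "f \<in> L2 M" "g \<in> L2 M"
  shows "set_integrable lborel {0..} (\<lambda>t. exp (- lam * t) * ipL2 M (P t f) g)"
proof (rule set_integrable_bound)
  show "set_integrable lborel {0..} (\<lambda>t. nrmL2 M f * nrmL2 M g * exp (- lam * t))"
    using integral_exp_minus_Ici(1)[OF assms(1)] by (rule set_integrable_mult_right)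
  show "set_borel_measurable lborel {0..} (\<lambda>t. exp (- lam * t) * ipL2 M (P t f) g)"
  proof -
    have "(\<lambda>t. indicator {0..} t *\<^sub>R (exp (- lam * t) * ipL2 M (P t f) g)) \<in> borel_measurable borel"
      using assms by (intro borel_measurable_continuous_on_indicator)
        (auto intro!: continuous_intros ipL2_P_continuous_on)
    then show ?thesis by (simp add: set_borel_measurable_def)
  qed
  show "AE t in lborel. t \<in> {0..} \<longrightarrow> norm (exp (- lam * t) * ipL2 M (P t f) g) \<le> norm (nrmL2 M f * nrmL2 M g * exp (- lam * t))"
    using ipL2_P_bound[OF _ assms(2,3)] by (intro AE_I2) (simp add: abs_mult mult.commute)
qed

lemma laplace_bound:
  assumes "lam > 0" "f \<in> L2 M" "g \<in> L2 M"
  shows "\<bar>laplace lam f g\<bar> \<le> nrmL2 M f * nrmL2 M g / lam"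
proof -
  have "norm (laplace lam f g) \<le> (LBINT t:{0..}. norm (exp (- lam * t) * ipL2 M (P t f) g))"
    unfolding laplace_def by (rule set_integral_norm_bound[OF laplace_integrable[OF assms]])
  also have "\<dots> \<le> (LBINT t:{0..}. nrmL2 M f * nrmL2 M g * exp (- lam * t))"
  proof (rule set_integral_mono)
    show "set_integrable lborel {0..} (\<lambda>t. norm (exp (- lam * t) * ipL2 M (P t f) g))"
      using laplace_integrable[OF assms] by (rule set_integrable_norm)
    show "set_integrable lborel {0..} (\<lambda>t. nrmL2 M f * nrmL2 M g * exp (- lam * t))"
      using integral_exp_minus_Ici(1)[OF assms(1)] by (rule set_integrable_mult_right)
    show "norm (exp (- lam * t) * ipL2 M (P t f) g) \<le> nrmL2 M f * nrmL2 M g * exp (- lam * t)" if "t \<in> {0..}" for t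
      using ipL2_P_bound[OF _ assms(2,3)] that by (simp add: abs_mult mult.commute)
  qed
  also have "\<dots> = nrmL2 M f * nrmL2 M g / lam"
    using integral_exp_minus_Ici(2)[OF assms(1)] by simp
  finally show ?thesis by simp
qed

lemma laplace_diff:
  assumes "lam > 0" "f \<in> L2 M" "f' \<in> L2 M" "g \<in> L2 M"
  shows "laplace lam (\<lambda>x. f x - f' x) g = laplace lam f g - laplace lam f' g"
proof -
  have "laplace lam (\<lambda>x. f x - f' x) g
      = (LBINT t:{0..}. exp (- lam * t) * ipL2 M (P t f) g - exp (- lam * t) * ipL2 M (P t f') g)"
    unfolding laplace_def
  proof (intro set_lebesgue_integral_cong allI impI)
    fix t :: real assume t: "t \<in> {0..}"
    have "ipL2 M (P t (\<lambda>x. f x - f' x)) g = ipL2 M (\<lambda>x. P t f x - P t f' x) g"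
      using assms t P_diff[of t f f'] by (intro ipL2_cong_left) auto
    then show "exp (- lam * t) * ipL2 M (P t (\<lambda>x. f x - f' x)) g =
        exp (- lam * t) * ipL2 M (P t f) g - exp (- lam * t) * ipL2 M (P t f') g"
      using assms t by (simp add: ipL2_linear right_diff_distrib)
  qed simp
  also have "\<dots> = laplace lam f g - laplace lam f' g"
    unfolding laplace_def using assms by (intro set_integral_diff(2) laplace_integrable)
  finally show ?thesis .
qed

text \<open>The integrand is the derivative of \<open>F\<close>, minus the discounted pairing, which
  decays at infinity. In weak form this says that the resolvent is a left inverse of
  \<open>lam - L\<close>.\<close>

lemma laplace_gen:
  assumes lam: "lam > 0" and f: "f \<in> gen_dom M P" and g: "g \<in> L2 M"
  shows "laplace lam (\<lambda>x. lam * f x - gen M P f x) g = ipL2 M f g"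
proof -
  note fp = gen_props[OF f]
  let ?k = "\<lambda>x. lam * f x - gen M P f x"
  let ?\<phi> = "\<lambda>t. exp (- lam * t) * ipL2 M (P t ?k) g"
  define F where "F t = - (exp (- lam * t) * ipL2 M (P t f) g)" for t
  have k: "?k \<in> L2 M" using fp by auto
  have deriv: "(F has_vector_derivative ?\<phi> t) (at t within {0..T})" if t: "0 \<le> t" for t T
  proof -
    have "ipL2 M (P t ?k) g = ipL2 M (\<lambda>x. lam * P t f x + (-1) * P t (gen M P f) x) g"
      using P_lincomb[of t f "gen M P f" lam "-1"] t fp g by (intro ipL2_cong_left) auto
    then have e: "ipL2 M (P t ?k) g = lam * ipL2 M (P t f) g - ipL2 M (P t (gen M P f)) g"
      using t fp g by (simp add: ipL2_linear)
    have "(F has_real_derivative ?\<phi> t) (at t within {0..})"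
      unfolding F_def e
      by (rule derivative_eq_intros ipL2_P_has_derivative[OF f g t] refl)+ (simp add: algebra_simps)
    then have "(F has_real_derivative ?\<phi> t) (at t within {0..T})"
      by (rule has_field_derivative_subset) auto
    then show ?thesis by (simp add: has_real_derivative_iff_has_vector_derivative)
  qed
  have ftc: "(\<integral>t. indicator {0..T} t *\<^sub>R ?\<phi> t \<partial>lborel) = F T - F 0" if "0 \<le> T" for T
    using that deriv continuous_on_subset[OF ipL2_P_continuous_on[OF k g], of "{0..T}"]
    by (intro integral_FTC_atLeastAtMost) (auto intro!: continuous_intros)
  have "((\<lambda>T. \<integral>t. indicator {..T} t *\<^sub>R (indicator {0..} t *\<^sub>R ?\<phi> t) \<partial>lborel) \<longlongrightarrow> laplace lam ?k g) at_top"
    unfolding laplace_def set_lebesgue_integral_def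
    using laplace_integrable[OF lam k g]
    by (intro tendsto_integral_at_top) (auto simp: set_integrable_def)
  moreover have "eventually (\<lambda>T. (\<integral>t. indicator {..T} t *\<^sub>R (indicator {0..} t *\<^sub>R ?\<phi> t) \<partial>lborel) = F T - F 0) at_top"
    using eventually_ge_at_top[of 0]
  proof eventually_elim
    case (elim T)
    show ?case unfolding ftc[OF elim, symmetric]
      by (intro Bochner_Integration.integral_cong) (auto simp: indicator_def)
  qed
  ultimately have 1: "((\<lambda>T. F T - F 0) \<longlongrightarrow> laplace lam ?k g) at_top"
    using tendsto_cong by fast
  have "(F \<longlongrightarrow> 0) at_top"
  proof (rule Lim_null_comparison)
    show "eventually (\<lambda>T. norm (F T) \<le> exp (- lam * T) * (nrmL2 M f * nrmL2 M g)) at_top"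
      using eventually_ge_at_top[of 0]
      by eventually_elim (use ipL2_P_bound[OF _ fp(1) g] in \<open>simp add: F_def abs_mult\<close>)
    have "filterlim (\<lambda>T. lam * T) at_top at_top"
      using lam by (intro filterlim_tendsto_pos_mult_at_top[OF tendsto_const _ filterlim_ident])
    then have "((\<lambda>T. exp (- (lam * T))) \<longlongrightarrow> 0) at_top"
      by (intro filterlim_compose[OF exp_at_bot]) (simp add: filterlim_uminus_at_bot)
    then show "((\<lambda>T. exp (- lam * T) * (nrmL2 M f * nrmL2 M g)) \<longlongrightarrow> 0) at_top"
      by (auto intro: tendsto_mult_left_zero)
  qed
  then have "((\<lambda>T. F T - F 0) \<longlongrightarrow> 0 - F 0) at_top" by (intro tendsto_intros)
  from tendsto_unique[OF _ 1 this] have "laplace lam ?k g = - F 0" by simp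
  also have "\<dots> = ipL2 M (P 0 f) g" by (simp add: F_def)
  also have "\<dots> = ipL2 M f g" using P_zero[OF fp(1)] fp g by (intro ipL2_cong_left) auto
  finally show ?thesis .
qed

end

section \<open>Resolvents\<close>

lemma le_if_mult_self_le: "(a::real) * a \<le> a * c \<Longrightarrow> 0 \<le> a \<Longrightarrow> 0 \<le> c \<Longrightarrow> a \<le> c"
  by (cases "a = 0") (auto simp: mult_le_cancel_left)

text \<open>The setting for L(\<beta>). The core property of \<open>A\<close> is not assumed here;
  density of the range of \<open>lam - L\<close> on \<open>A\<close> is derived from density and
  invariance of \<open>A\<close>.\<close>

locale invariant_core = contraction_sg M P for M :: "'e measure" and P +
  fixes A :: "('e \<Rightarrow> real) set"
  assumes closed: "closed_generator M P"
    and A_dom: "A \<subseteq> gen_dom M P"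
    and A_lincomb: "\<And>f g a b. f \<in> A \<Longrightarrow> g \<in> A \<Longrightarrow> (\<lambda>x. a * f x + b * g x) \<in> A"
    and A_dense: "dense_L2 M A"
    and A_inv: "\<And>f t. f \<in> A \<Longrightarrow> t \<ge> 0 \<Longrightarrow> P t f \<in> A"
begin

lemma A_L2: "f \<in> A \<Longrightarrow> f \<in> L2 M"
  using A_dense by (auto simp: dense_L2_def)

lemma orthogonal_core_imp_0:
  assumes h: "h \<in> L2 M" and orth: "\<And>f. f \<in> A \<Longrightarrow> ipL2 M f h = 0"
  shows "nrmL2 M h = 0"
proof (rule ccontr)
  assume "nrmL2 M h \<noteq> 0"
  then have pos: "nrmL2 M h > 0" using nrmL2_nonneg[of M h] by linarith
  then obtain a where a: "a \<in> A" "nrmL2 M (\<lambda>x. h x - a x) < nrmL2 M h"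
    using A_dense h unfolding dense_L2_def by blast
  have "(nrmL2 M h)\<^sup>2 = ipL2 M (\<lambda>x. h x - a x) h"
    using h a A_L2 orth[OF a(1)] by (simp add: nrmL2_sq ipL2_linear)
  also have "\<dots> \<le> nrmL2 M (\<lambda>x. h x - a x) * nrmL2 M h"
    using ipL2_Cauchy_Schwarz[of "\<lambda>x. h x - a x" M h] h a A_L2 by simp
  also have "\<dots> < nrmL2 M h * nrmL2 M h" using a pos by simp
  finally show False by (simp add: power2_eq_square)
qed

text \<open>If \<open>h\<close> is orthogonal to the range of \<open>lam - L\<close> on \<open>A\<close>, then by invariance of \<open>A\<close> the integrand
  in the Laplace representation of \<open>ipL2 M f h\<close> vanishes for every \<open>f\<close> in \<open>A\<close>.\<close>
lemma range_dense:
  assumes lam: "lam > 0" and f: "f \<in> L2 M"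
  shows "\<exists>x. (\<forall>n. x n \<in> A) \<and> tendsL2 M (\<lambda>n y. lam * x n y - gen M P (x n) y) f sequentially"
proof -
  define k where "k x = (\<lambda>y. lam * x y - gen M P x y)" for x
  have kL2: "k x \<in> L2 M" if "x \<in> A" for x
    unfolding k_def using gen_props[of x] A_dom that by auto
  \<comment> \<open>Saturation under almost everywhere equality is essential:
    \<open>P t (k x)\<close> agrees with \<open>k (P t x)\<close> only almost everywhere.\<close>
  define V where "V = {v \<in> L2 M. \<exists>x\<in>A. eqL2 M v (k x)}"
  have "\<exists>v. (\<forall>n. v n \<in> V) \<and> tendsL2 M v f sequentially"
  proof (rule orthogonal_trivial_imp_dense)
    show "V \<subseteq> L2 M" by (auto simp: V_def)
    obtain a where a: "a \<in> A" using A_dense f unfolding dense_L2_def by (meson zero_less_one)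
    then have "k a \<in> V" using kL2 by (auto simp: V_def eqL2_def)
    then show "V \<noteq> {}" by auto
    show "(\<lambda>x. a * u x + b * v x) \<in> V" if uv: "u \<in> V" "v \<in> V" for u v a b
    proof -
      obtain x y where x: "x \<in> A" "eqL2 M u (k x)" and y: "y \<in> A" "eqL2 M v (k y)"
        using uv by (auto simp: V_def)
      have "eqL2 M (\<lambda>z. a * u z + b * v z) (k (\<lambda>z. a * x z + b * y z))"
      proof (rule eqL2_imp3[OF x(2) y(2) gen_lincomb(2)[of x y a b]])
        fix z
        assume h: "u z = k x z" "v z = k y z"
          "gen M P (\<lambda>z. a * x z + b * y z) z = a * gen M P x z + b * gen M P y z"
        show "a * u z + b * v z = k (\<lambda>z. a * x z + b * y z) z"
          unfolding h(1,2) k_def h(3) by (simp add: algebra_simps)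
      qed (use x(1) y(1) A_dom in auto)
      then show ?thesis using uv A_lincomb[OF x(1) y(1)] by (auto simp: V_def)
    qed
    show "nrmL2 M h = 0" if h: "h \<in> L2 M" and orth: "\<And>v. v \<in> V \<Longrightarrow> ipL2 M v h = 0" for h
    proof (rule orthogonal_core_imp_0[OF h])
      fix x assume x: "x \<in> A"
      then have xd: "x \<in> gen_dom M P" using A_dom by auto
      note xp = gen_props[OF xd]
      have "ipL2 M (P t (k x)) h = 0" if t: "t \<ge> 0" for t
      proof (rule orth)
        have "eqL2 M (P t (k x)) (k (P t x))"
          unfolding k_def
          by (rule eqL2_imp2[OF P_lincomb[OF t xp(1,2), of lam "-1"] gen_P_commute(2)[OF xd t]]) simp
        then show "P t (k x) \<in> V" using t kL2[OF x] A_inv[OF x t] by (auto simp: V_def)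
      qed
      then have "laplace lam (k x) h = 0"
        unfolding laplace_def set_lebesgue_integral_def
        by (intro integral_eq_zero_AE AE_I2) (auto simp: indicator_def)
      then show "ipL2 M x h = 0" using laplace_gen[OF lam xd h] by (simp add: k_def)
    qed
  qed (rule f)
  then obtain v where v: "\<And>n. v n \<in> V" "tendsL2 M v f sequentially" by auto
  then have "\<forall>n. \<exists>x. x \<in> A \<and> eqL2 M (v n) (k x)" by (auto simp: V_def)
  then obtain x where x: "\<And>n. x n \<in> A" "\<And>n. eqL2 M (v n) (k (x n))" by metis
  have "tendsL2 M (\<lambda>n. k (x n)) f sequentially"
    using v x kL2 f by (intro tendsL2_cong_AE[OF v(2)]) (auto simp: V_def)
  then show ?thesis using x(1) by (auto simp: k_def)
qed

text \<open>Pair \<open>(lam - L) x\<close> with \<open>x\<close> and drop the dissipative term.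
  This a priori bound makes preimages of convergent sequences Cauchy and later compares resolvents
  for different \<beta>.\<close>

lemma nrmL2_le_range:
  assumes lam: "lam > 0" and x: "x \<in> gen_dom M P"
  shows "nrmL2 M x \<le> nrmL2 M (\<lambda>y. lam * x y - gen M P x y) / lam"
proof -
  note xp = gen_props[OF x]
  let ?k = "\<lambda>y. lam * x y - gen M P x y"
  have "lam * (nrmL2 M x * nrmL2 M x) = ipL2 M x ?k + ipL2 M x (gen M P x)"
    using xp by (simp add: ipL2_linear nrmL2_sq flip: power2_eq_square)
  also have "\<dots> \<le> ipL2 M x ?k" using gen_dissipative[OF x] by simp
  also have "\<dots> \<le> nrmL2 M x * nrmL2 M ?k" using ipL2_Cauchy_Schwarz[of x M ?k] xp by simp
  finally have "nrmL2 M x * (lam * nrmL2 M x) \<le> nrmL2 M x * nrmL2 M ?k" by (simp add: algebra_simps)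
  then have "lam * nrmL2 M x \<le> nrmL2 M ?k"
    using nrmL2_nonneg[of M x] nrmL2_nonneg[of M ?k] by (cases "nrmL2 M x = 0") auto
  then show ?thesis using lam by (simp add: field_simps)
qed

text \<open>Shows that the choice in \<open>resolvent\<close> is not vacuous. Preimages of vectors
  tending to \<open>f\<close> are Cauchy by the a priori bound, and their limit has the required
  pairings: \<open>laplace_gen\<close> computes them along the sequence and
  \<open>laplace_bound\<close> controls the error. The sequence is exported because later arguments
  compute on \<open>A\<close> and pass to the limit.\<close>

lemma resolvent_approx:
  assumes lam: "lam > 0" and f: "f \<in> L2 M"
  obtains x where "\<And>n. x n \<in> A" "tendsL2 M (\<lambda>n y. lam * x n y - gen M P (x n) y) f sequentially"
    "tendsL2 M x (resolvent M P lam f) sequentially"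
    "resolvent M P lam f \<in> L2 M" "\<And>g. g \<in> L2 M \<Longrightarrow> ipL2 M (resolvent M P lam f) g = laplace lam f g"
proof -
  obtain x where x: "\<And>n. x n \<in> A" "tendsL2 M (\<lambda>n y. lam * x n y - gen M P (x n) y) f sequentially"
    using range_dense[OF assms] by auto
  define k where "k n = (\<lambda>y. lam * x n y - gen M P (x n) y)" for n
  have xd: "x n \<in> gen_dom M P" for n using x A_dom by auto
  note xp = gen_props[OF xd]
  have kL2: "k n \<in> L2 M" for n unfolding k_def using xp by auto
  have kf: "(\<lambda>n. nrmL2 M (\<lambda>y. k n y - f y)) \<longlonglongrightarrow> 0" using x(2) by (simp add: k_def tendsL2_def)
  have diff: "nrmL2 M (\<lambda>y. x m y - x n y)
      \<le> (nrmL2 M (\<lambda>y. k m y - f y) + nrmL2 M (\<lambda>y. k n y - f y)) / lam" for m n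
  proof -
    have d: "(\<lambda>y. x m y - x n y) \<in> gen_dom M P" "eqL2 M (gen M P (\<lambda>y. x m y - x n y)) (\<lambda>y. gen M P (x m) y - gen M P (x n) y)"
      using gen_lincomb[OF xd[of m] xd[of n], of 1 "-1"] by simp_all
    have "eqL2 M (\<lambda>y. lam * (x m y - x n y) - gen M P (\<lambda>y. x m y - x n y) y) (\<lambda>y. k m y - k n y)"
      by (rule eqL2_imp[OF d(2)]) (simp add: k_def algebra_simps)
    then have "nrmL2 M (\<lambda>y. lam * (x m y - x n y) - gen M P (\<lambda>y. x m y - x n y) y) = nrmL2 M (\<lambda>y. k m y - k n y)"
      using xp kL2 gen_props[OF d(1)] by (intro nrmL2_cong) auto
    also have "\<dots> \<le> nrmL2 M (\<lambda>y. k m y - f y) + nrmL2 M (\<lambda>y. k n y - f y)"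
      using nrmL2_triangle3[OF kL2[of m] f kL2[of n]] by (simp add: nrmL2_minus_commute[of M f])
    finally show ?thesis
      using nrmL2_le_range[OF lam d(1)] lam by (simp add: divide_right_mono order_trans)
  qed
  have "\<exists>N. \<forall>m\<ge>N. \<forall>n\<ge>N. nrmL2 M (\<lambda>y. x m y - x n y) < e" if e: "e > 0" for e
  proof -
    have "eventually (\<lambda>n. nrmL2 M (\<lambda>y. k n y - f y) < lam * e / 2) sequentially"
      using order_tendstoD(2)[OF kf, of "lam * e / 2"] lam e by simp
    then obtain N where N: "\<And>n. n \<ge> N \<Longrightarrow> nrmL2 M (\<lambda>y. k n y - f y) < lam * e / 2"
      by (auto simp: eventually_sequentially)
    have "nrmL2 M (\<lambda>y. x m y - x n y) < e" if "m \<ge> N" "n \<ge> N" for m n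
    proof (rule le_less_trans[OF diff])
      show "(nrmL2 M (\<lambda>y. k m y - f y) + nrmL2 M (\<lambda>y. k n y - f y)) / lam < e"
        using N[OF that(1)] N[OF that(2)] lam by (simp add: field_simps)
    qed
    then show ?thesis by blast
  qed
  from L2_complete[of x, OF xp(1) this]
  obtain r where r: "r \<in> L2 M" "tendsL2 M x r sequentially" by auto
  have r_lap: "ipL2 M r g = laplace lam f g" if g: "g \<in> L2 M" for g
  proof -
    have "(\<lambda>n. ipL2 M (x n) g) \<longlonglongrightarrow> ipL2 M r g"
      using r xp g by (intro tendsL2_ipL2_left) auto
    moreover have "(\<lambda>n. ipL2 M (x n) g - laplace lam f g) \<longlonglongrightarrow> 0"
    proof (rule Lim_null_comparison[OF always_eventually[OF allI]])
      fix n
      have "ipL2 M (x n) g - laplace lam f g = laplace lam (\<lambda>y. k n y - f y) g"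
        using laplace_gen[OF lam xd[of n] g] laplace_diff[OF lam kL2[of n] f g] by (simp add: k_def)
      then show "norm (ipL2 M (x n) g - laplace lam f g) \<le> nrmL2 M (\<lambda>y. k n y - f y) * (nrmL2 M g / lam)"
        using laplace_bound[OF lam _ g, of "\<lambda>y. k n y - f y"] kL2 f by simp
      show "(\<lambda>n. nrmL2 M (\<lambda>y. k n y - f y) * (nrmL2 M g / lam)) \<longlonglongrightarrow> 0"
        using kf by (rule tendsto_mult_left_zero)
    qed
    then have "(\<lambda>n. ipL2 M (x n) g) \<longlonglongrightarrow> laplace lam f g" by (simp add: LIM_zero_iff)
    ultimately show ?thesis by (rule LIMSEQ_unique)
  qed
  let ?R = "resolvent M P lam f"
  have "\<exists>r. r \<in> L2 M \<and> (\<forall>g\<in>L2 M. ipL2 M r g = (LBINT t:{0..}. exp (- lam * t) * ipL2 M (P t f) g))"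
    using r(1) r_lap by (auto simp: laplace_def)
  from someI_ex[OF this] have R: "?R \<in> L2 M" "\<And>g. g \<in> L2 M \<Longrightarrow> ipL2 M ?R g = laplace lam f g"
    unfolding resolvent_def laplace_def by auto
  \<comment> \<open>Pairings determine a vector up to a null set, so the chosen resolvent is this
    limit.\<close>
  have "eqL2 M r ?R" using r(1) R r_lap by (intro eqL2_if_ipL2_eq) auto
  then have "nrmL2 M (\<lambda>y. r y - ?R y) = 0" using r(1) R by (simp add: eqL2_iff_nrmL2)
  then have "nrmL2 M (\<lambda>y. x n y - ?R y) \<le> nrmL2 M (\<lambda>y. x n y - r y)" for n
    using nrmL2_triangle3[OF xp(1)[of n] r(1) R(1)] by simp
  then have "tendsL2 M x ?R sequentially"
    using r(2) unfolding tendsL2_def[of M x r] by (intro tendsL2_bound) auto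
  then show ?thesis using that x R by blast
qed

lemma resolvent_L2: "lam > 0 \<Longrightarrow> f \<in> L2 M \<Longrightarrow> resolvent M P lam f \<in> L2 M"
  by (rule resolvent_approx[of lam f])

lemma ipL2_resolvent: "lam > 0 \<Longrightarrow> f \<in> L2 M \<Longrightarrow> g \<in> L2 M \<Longrightarrow> ipL2 M (resolvent M P lam f) g = laplace lam f g"
  by (rule resolvent_approx[of lam f])

text \<open>Testing the difference against itself turns the bound on the scalar integral into a norm
  bound.\<close>

lemma resolvent_bound_diff:
  assumes lam: "lam > 0" and f: "f \<in> L2 M" and g: "g \<in> L2 M"
  shows "nrmL2 M (\<lambda>y. resolvent M P lam f y - resolvent M P lam g y) \<le> nrmL2 M (\<lambda>y. f y - g y) / lam"
proof -
  let ?d = "\<lambda>y. resolvent M P lam f y - resolvent M P lam g y"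
  have d: "?d \<in> L2 M" using assms resolvent_L2 by auto
  have "nrmL2 M ?d * nrmL2 M ?d = ipL2 M ?d ?d" by (simp add: nrmL2_sq flip: power2_eq_square)
  also have "\<dots> = ipL2 M (resolvent M P lam f) ?d - ipL2 M (resolvent M P lam g) ?d"
    using assms resolvent_L2 d by (subst ipL2_diff_left) auto
  also have "\<dots> = laplace lam (\<lambda>y. f y - g y) ?d"
    using assms d by (simp add: ipL2_resolvent laplace_diff)
  also have "\<dots> \<le> nrmL2 M ?d * (nrmL2 M (\<lambda>y. f y - g y) / lam)"
    using laplace_bound[OF lam, of "\<lambda>y. f y - g y" ?d] d f g by (simp add: mult.commute)
  finally show ?thesis
    by (rule le_if_mult_self_le) (use lam in auto)
qed

text \<open>Convergence of \<open>x\<close> and of \<open>(lam - L) x\<close> gives convergence of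
  \<open>L x\<close> by subtraction, that is, approximation in the graph norm.\<close>

lemma resolvent_approx_gen:
  assumes lam: "lam > 0" and f: "f \<in> L2 M"
  obtains x where "\<And>n. x n \<in> A" "tendsL2 M x (resolvent M P lam f) sequentially"
    "tendsL2 M (\<lambda>n. gen M P (x n)) (\<lambda>y. lam * resolvent M P lam f y - f y) sequentially"
proof (rule resolvent_approx[OF assms])
  fix x assume x: "\<And>n. x n \<in> A" "tendsL2 M (\<lambda>n y. lam * x n y - gen M P (x n) y) f sequentially"
    "tendsL2 M x (resolvent M P lam f) sequentially" "resolvent M P lam f \<in> L2 M"
  have xd: "x n \<in> gen_dom M P" for n using x A_dom by auto
  note xp = gen_props[OF xd]
  have "tendsL2 M (\<lambda>n y. lam * x n y + (-1) * (lam * x n y - gen M P (x n) y))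
      (\<lambda>y. lam * resolvent M P lam f y + (-1) * f y) sequentially"
    using x xp f by (intro tendsL2_lincomb) auto
  then have "tendsL2 M (\<lambda>n. gen M P (x n)) (\<lambda>y. lam * resolvent M P lam f y - f y) sequentially" by simp
  then show thesis by (rule that[OF x(1,3)])
qed

lemma gen_resolvent:
  assumes lam: "lam > 0" and f: "f \<in> L2 M"
  shows "resolvent M P lam f \<in> gen_dom M P"
    "eqL2 M (gen M P (resolvent M P lam f)) (\<lambda>y. lam * resolvent M P lam f y - f y)"
proof -
  obtain x where x: "\<And>n. x n \<in> A" "tendsL2 M x (resolvent M P lam f) sequentially"
    "tendsL2 M (\<lambda>n. gen M P (x n)) (\<lambda>y. lam * resolvent M P lam f y - f y) sequentially"
    using resolvent_approx_gen[OF assms] by metis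
  have "\<forall>n. x n \<in> gen_dom M P" using x A_dom by auto
  moreover have "resolvent M P lam f \<in> L2 M" "(\<lambda>y. lam * resolvent M P lam f y - f y) \<in> L2 M"
    using resolvent_L2[OF assms] f by auto
  ultimately show "resolvent M P lam f \<in> gen_dom M P"
    "eqL2 M (gen M P (resolvent M P lam f)) (\<lambda>y. lam * resolvent M P lam f y - f y)"
    using closed[unfolded closed_generator_def, rule_format, of x] x by (auto simp: convL2_iff_tendsL2)
qed

end

section \<open>Markov semigroups are contractive\<close>

text \<open>The Huber function: the supremum of the tangents \<open>2 a y - a\<^sup>2\<close> of \<open>y\<^sup>2\<close> with slope parameter
  \<open>\<bar>a\<bar> \<le> n\<close>. It grows linearly, so \<open>huber n \<circ> f\<close> is again square integrable.\<close>
definition huber :: "real \<Rightarrow> real \<Rightarrow> real" where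
  "huber n y = (if \<bar>y\<bar> \<le> n then y\<^sup>2 else 2 * n * \<bar>y\<bar> - n\<^sup>2)"

lemma huber_ge_tangent: "\<bar>a\<bar> \<le> n \<Longrightarrow> 2 * a * y - a\<^sup>2 \<le> huber n y"
proof (cases "\<bar>y\<bar> \<le> n")
  case True
  then show ?thesis using zero_le_power2[of "y - a"] by (simp add: huber_def power2_diff algebra_simps)
next
  case False
  assume a: "\<bar>a\<bar> \<le> n"
  have "a * y \<le> \<bar>a\<bar> * \<bar>y\<bar>" by (metis abs_ge_self abs_mult)
  \<comment> \<open>The product is the gap between the affine branch of \<open>huber\<close> and
    \<open>2 * (\<bar>a\<bar> * \<bar>y\<bar>) - a\<^sup>2\<close>.\<close>
  moreover have "0 \<le> (n - \<bar>a\<bar>) * (2 * \<bar>y\<bar> - n - \<bar>a\<bar>)"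
    using a False by (intro mult_nonneg_nonneg) auto
  moreover have "(n - \<bar>a\<bar>) * (2 * \<bar>y\<bar> - n - \<bar>a\<bar>) = 2 * n * \<bar>y\<bar> - n\<^sup>2 - 2 * (\<bar>a\<bar> * \<bar>y\<bar>) + a\<^sup>2"
    by (simp add: algebra_simps power2_eq_square)
  ultimately show ?thesis using False by (simp add: huber_def)
qed

lemma huber_le_sq: "n \<ge> 0 \<Longrightarrow> huber n y \<le> y\<^sup>2"
  using zero_le_power2[of "\<bar>y\<bar> - n"] by (simp add: huber_def power2_diff algebra_simps)

lemma huber_nonneg: "n \<ge> 0 \<Longrightarrow> 0 \<le> huber n y"
  using huber_ge_tangent[of 0 n y] by simp

lemma huber_le_linear: "n \<ge> 0 \<Longrightarrow> huber n y \<le> 2 * n * \<bar>y\<bar>"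
proof (cases "\<bar>y\<bar> \<le> n")
  case True
  assume n: "n \<ge> 0"
  have "y\<^sup>2 = \<bar>y\<bar> * \<bar>y\<bar>" by (simp add: power2_eq_square)
  also have "\<dots> \<le> n * \<bar>y\<bar>" using True by (intro mult_right_mono) auto
  also have "\<dots> \<le> 2 * n * \<bar>y\<bar>" using n by simp
  finally show ?thesis using True by (simp add: huber_def)
qed (simp add: huber_def)

lemma huber_measurable [measurable]: "huber n \<in> borel_measurable borel"
  unfolding huber_def[abs_def] by measurable

lemma huber_tendsto: "(\<lambda>n. huber (real n) y) \<longlonglongrightarrow> y\<^sup>2"
proof (rule tendsto_eventually)
  obtain N :: nat where "\<bar>y\<bar> \<le> real N" using real_arch_simple by blast
  then show "eventually (\<lambda>n. huber (real n) y = y\<^sup>2) sequentially"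
    by (intro eventually_sequentiallyI[of N]) (auto simp: huber_def)
qed

text \<open>Restricting to rational slopes leaves only countably many almost everywhere inequalities to combine.\<close>
lemma huber_le_if_rational_tangents:
  assumes n: "n \<ge> 0" and le: "\<And>r. r \<in> \<rat> \<Longrightarrow> \<bar>r\<bar> \<le> n \<Longrightarrow> 2 * r * y - r\<^sup>2 \<le> c"
  shows "huber n y \<le> c"
proof (cases "n = 0")
  case True
  then show ?thesis using le[of 0] by (simp add: huber_def)
next
  case False
  \<comment> \<open>Clipping \<open>y\<close> to the admissible slopes gives the tangent that
    attains the supremum.\<close>
  define a where "a = max (- n) (min n y)"
  have an: "\<bar>a\<bar> \<le> n" using n by (auto simp: a_def)
  have eq: "huber n y = 2 * a * y - a\<^sup>2"
    using n by (auto simp: a_def huber_def power2_eq_square)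
  show ?thesis
  proof (rule ccontr)
    assume "\<not> ?thesis"
    then have less: "c < 2 * a * y - a\<^sup>2" by (simp add: eq)
    have "((\<lambda>r. 2 * r * y - r\<^sup>2) \<longlongrightarrow> 2 * a * y - a\<^sup>2) (at a within {-n<..<n})"
      by (intro tendsto_intros)
    from order_tendstoD(1)[OF this less]
    obtain d where d: "d > 0" "\<And>r. r \<in> {-n<..<n} \<Longrightarrow> r \<noteq> a \<Longrightarrow> dist r a < d \<Longrightarrow> c < 2 * r * y - r\<^sup>2"
      by (auto simp: eventually_at)
    \<comment> \<open>The rational slope is sought near \<open>a\<close> but strictly between -n and
      n; this interval is empty for \<open>n = 0\<close>, hence the separate case.\<close>
    obtain r where r: "r \<in> \<rat>" "max (- n) (a - d) < r" "r < min n (a + d)"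
    proof -
      have "max (- n) (a - d) < min n (a + d)" using an d(1) n False by auto
      from Rats_dense_in_real[OF this] show ?thesis using that by auto
    qed
    then have "c < 2 * r * y - r\<^sup>2"
      using d(2)[of r] less by (cases "r = a") (auto simp: dist_real_def abs_less_iff)
    moreover have "2 * r * y - r\<^sup>2 \<le> c" using r by (intro le) auto
    ultimately show False by simp
  qed
qed

text \<open>Jensen's inequality without a kernel. As \<open>T\<close> preserves order and constants,
  each tangent evaluated at \<open>T f\<close> lies below \<open>T\<close> of the Huber transform of
  \<open>f\<close>; take the supremum over slopes, integrate using invariance, and let the
  truncation level grow. Truncation is forced because the square of \<open>f\<close> is merely
  integrable and may lie outside the domain of \<open>T\<close>.\<close>

lemma (in prob_space) markov_operator_contraction:
  assumes T: "L2_op M T"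
    and pos: "\<And>f. f \<in> L2 M \<Longrightarrow> AE x in M. 0 \<le> f x \<Longrightarrow> AE x in M. 0 \<le> T f x"
    and one: "eqL2 M (T (\<lambda>_. 1)) (\<lambda>_. 1)"
    and inv: "\<And>f. f \<in> L2 M \<Longrightarrow> (\<integral>x. T f x \<partial>M) = (\<integral>x. f x \<partial>M)"
    and f: "f \<in> L2 M"
  shows "nrmL2 M (T f) \<le> nrmL2 M f"
proof -
  have TL2: "T g \<in> L2 M" if "g \<in> L2 M" for g using T that by (auto simp: L2_op_def)
  have lin: "eqL2 M (T (\<lambda>x. a * g x + b * h x)) (\<lambda>x. a * T g x + b * T h x)"
    if "g \<in> L2 M" "h \<in> L2 M" for g h a b using T that by (auto simp: L2_op_def)
  have oneL2: "(\<lambda>_. 1) \<in> L2 M" by (simp add: L2_def)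
  have int: "integrable M g" if "g \<in> L2 M" for g
    using L2_integrable_mult[OF that oneL2] by simp
  have mf [measurable]: "f \<in> borel_measurable M" "T f \<in> borel_measurable M"
    using f TL2[OF f] by (auto intro: L2_measurable)
  have bound: "(\<integral>x. huber n (T f x) \<partial>M) \<le> (\<integral>x. (f x)\<^sup>2 \<partial>M)" if n: "n \<ge> 0" for n
  proof -
    let ?h = "\<lambda>x. huber n (f x)"
    have "integrable M (\<lambda>x. (?h x)\<^sup>2)"
    proof (rule Bochner_Integration.integrable_bound)
      show "integrable M (\<lambda>x. (2 * n)\<^sup>2 * (f x)\<^sup>2)" using f by (auto simp: L2_def)
      have "(?h x)\<^sup>2 \<le> (2 * n)\<^sup>2 * (f x)\<^sup>2" for x
      proof -
        have "(?h x)\<^sup>2 \<le> (2 * n * \<bar>f x\<bar>)\<^sup>2"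
          using n by (intro power_mono huber_le_linear huber_nonneg)
        then show ?thesis by (simp add: power_mult_distrib)
      qed
      then show "AE x in M. norm ((?h x)\<^sup>2) \<le> norm ((2 * n)\<^sup>2 * (f x)\<^sup>2)"
        by (intro AE_I2) simp
    qed simp
    then have hL2: "?h \<in> L2 M" by (simp add: L2_def)
    have "AE x in M. 2 * r * T f x - r\<^sup>2 \<le> T ?h x" if r: "\<bar>r\<bar> \<le> n" for r
    proof -
      \<comment> \<open>The constant is written as a multiple of 1 so that linearity and
        \<open>one\<close> evaluate \<open>T\<close> on it.\<close>
      let ?l = "\<lambda>x. (2 * r) * f x + (- r\<^sup>2) * 1"
      let ?d = "\<lambda>x. 1 * ?h x + (-1) * ?l x"
      have lL2: "?l \<in> L2 M" using f oneL2 by (rule L2_lincomb)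
      have "0 \<le> ?d x" for x using huber_ge_tangent[OF r, of "f x"] by simp
      then have "AE x in M. 0 \<le> T ?d x"
        using L2_lincomb[OF hL2 lL2, of 1 "-1"] by (intro pos AE_I2)
      then show ?thesis
        using lin[OF hL2 lL2, of 1 "-1"] lin[OF f oneL2, of "2 * r" "- r\<^sup>2"] one
        unfolding eqL2_def by eventually_elim simp
    qed
    then have "AE x in M. \<forall>r\<in>{r \<in> \<rat>. \<bar>r\<bar> \<le> n}. 2 * r * T f x - r\<^sup>2 \<le> T ?h x"
      by (subst AE_ball_countable) (auto intro: countable_subset[OF _ countable_rat])
    then have "AE x in M. huber n (T f x) \<le> T ?h x"
      by eventually_elim (auto intro!: huber_le_if_rational_tangents n)
    moreover have "integrable M (\<lambda>x. huber n (T f x))"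
    proof (rule Bochner_Integration.integrable_bound)
      show "integrable M (\<lambda>x. (T f x)\<^sup>2)" using TL2[OF f] by (auto simp: L2_def)
      show "AE x in M. norm (huber n (T f x)) \<le> norm ((T f x)\<^sup>2)"
        using n by (intro AE_I2) (simp add: huber_nonneg huber_le_sq)
    qed simp
    ultimately have "(\<integral>x. huber n (T f x) \<partial>M) \<le> (\<integral>x. T ?h x \<partial>M)"
      using int[OF TL2[OF hL2]] by (intro integral_mono_AE) auto
    also have "\<dots> = (\<integral>x. ?h x \<partial>M)" by (rule inv[OF hL2])
    also have "\<dots> \<le> (\<integral>x. (f x)\<^sup>2 \<partial>M)"
      using int[OF hL2] f n by (intro integral_mono) (auto simp: L2_def huber_le_sq)
    finally show ?thesis .
  qed
  have "(\<lambda>n. \<integral>x. huber (real n) (T f x) \<partial>M) \<longlonglongrightarrow> (\<integral>x. (T f x)\<^sup>2 \<partial>M)"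
  proof (rule integral_dominated_convergence[where w = "\<lambda>x. (T f x)\<^sup>2"])
    show "integrable M (\<lambda>x. (T f x)\<^sup>2)" using TL2[OF f] by (auto simp: L2_def)
  qed (auto simp: huber_tendsto huber_nonneg huber_le_sq)
  then have "(\<integral>x. (T f x)\<^sup>2 \<partial>M) \<le> (\<integral>x. (f x)\<^sup>2 \<partial>M)"
    by (rule LIMSEQ_le_const2) (use bound in auto)
  then show ?thesis by (simp add: nrmL2_def)
qed

lemma markov_sc_contraction_semigroup:
  assumes "prob_space M" "sc_markov_semigroup M P" "invariant_distr M P"
  shows "sc_contraction_semigroup M P"
proof -
  have "nrmL2 M (P t f) \<le> nrmL2 M f" if "t \<ge> 0" "f \<in> L2 M" for t f
    using assms(2,3) that
    by (intro prob_space.markov_operator_contraction[OF assms(1)])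
       (auto simp: sc_markov_semigroup_def sc_semigroup_def invariant_distr_def)
  then show ?thesis using assms(2) by (auto simp: sc_contraction_semigroup_def sc_markov_semigroup_def)
qed

text \<open>The choice depends only on the pairings, so almost everywhere agreement of the
  semigroups gives literal equality.\<close>

lemma resolvent_cong:
  assumes "\<And>t f. t \<ge> 0 \<Longrightarrow> f \<in> L2 M \<Longrightarrow> P t f \<in> L2 M \<and> P' t f \<in> L2 M \<and> eqL2 M (P t f) (P' t f)" "f \<in> L2 M"
  shows "resolvent M P lam f = resolvent M P' lam f"
proof -
  have "(LBINT t:{0..}. exp (- lam * t) * ipL2 M (P t f) g) = (LBINT t:{0..}. exp (- lam * t) * ipL2 M (P' t f) g)"
    if "g \<in> L2 M" for g
  proof (intro set_lebesgue_integral_cong allI impI)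
    fix t :: real assume "t \<in> {0..}"
    then have "ipL2 M (P t f) g = ipL2 M (P' t f) g"
      using assms that by (intro ipL2_cong_left) auto
    then show "exp (- lam * t) * ipL2 M (P t f) g = exp (- lam * t) * ipL2 M (P' t f) g" by simp
  qed simp
  then show ?thesis unfolding resolvent_def by (intro arg_cong[of _ _ Eps]) auto
qed

section \<open>Isometric involutions and Q-self-adjointness\<close>

locale isometric_involution =
  fixes M :: "'e measure" and Q :: "('e \<Rightarrow> real) \<Rightarrow> ('e \<Rightarrow> real)"
  assumes Q: "iso_involution M Q"
begin

lemma Q_L2 [simp, intro]: "f \<in> L2 M \<Longrightarrow> Q f \<in> L2 M"
  using Q by (auto simp: iso_involution_def L2_op_def)

lemma Q_cong: "f \<in> L2 M \<Longrightarrow> g \<in> L2 M \<Longrightarrow> eqL2 M f g \<Longrightarrow> eqL2 M (Q f) (Q g)"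
  using Q by (auto simp: iso_involution_def L2_op_def)

lemma Q_lincomb:
  "f \<in> L2 M \<Longrightarrow> g \<in> L2 M \<Longrightarrow> eqL2 M (Q (\<lambda>x. a * f x + b * g x)) (\<lambda>x. a * Q f x + b * Q g x)"
  using Q by (auto simp: iso_involution_def L2_op_def)

lemma Q_Q: "f \<in> L2 M \<Longrightarrow> eqL2 M (Q (Q f)) f"
  using Q by (auto simp: iso_involution_def)

text \<open>An isometry that is its own inverse is its own adjoint.\<close>

lemma ipL2_Q_left:
  assumes "f \<in> L2 M" "g \<in> L2 M"
  shows "ipL2 M (Q f) g = ipL2 M f (Q g)"
proof -
  have "ipL2 M f (Q g) = ipL2 M (Q f) (Q (Q g))"
    using Q assms by (auto simp: iso_involution_def)
  also have "\<dots> = ipL2 M (Q f) g"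
    using assms Q_Q by (intro ipL2_cong_right) auto
  finally show ?thesis by simp
qed

lemma nrmL2_Q_diff:
  assumes "f \<in> L2 M" "g \<in> L2 M"
  shows "nrmL2 M (\<lambda>x. Q f x - Q g x) = nrmL2 M (\<lambda>x. f x - g x)"
proof -
  have "nrmL2 M (\<lambda>x. Q f x - Q g x) = nrmL2 M (Q (\<lambda>x. f x - g x))"
    using assms Q_lincomb[of f g 1 "-1"] by (intro nrmL2_cong eqL2_sym[of M "Q _"]) auto
  also have "\<dots> = nrmL2 M (\<lambda>x. f x - g x)"
    using Q assms by (auto simp: nrmL2_eq_sqrt_ip iso_involution_def)
  finally show ?thesis .
qed

lemma tendsL2_Q:
  assumes "tendsL2 M F f net" "eventually (\<lambda>t. F t \<in> L2 M) net" "f \<in> L2 M"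
  shows "tendsL2 M (\<lambda>t. Q (F t)) (Q f) net"
proof (rule tendsL2_bound)
  show "eventually (\<lambda>t. nrmL2 M (\<lambda>x. Q (F t) x - Q f x) \<le> nrmL2 M (\<lambda>x. F t x - f x)) net"
    using assms(2) by eventually_elim (simp add: nrmL2_Q_diff assms(3))
qed (use assms(1) in \<open>simp add: tendsL2_def\<close>)

text \<open>Q-self-adjointness together with the involution makes \<open>Q\<close> composed with
  \<open>P t\<close> symmetric; difference quotients at 0 carry this over to the generator.\<close>

lemma gen_Q_symmetric:
  assumes "contraction_sg M P" and sa: "Q_selfadjoint M Q P"
    and x: "x \<in> gen_dom M P" and y: "y \<in> gen_dom M P"
  shows "ipL2 M (gen M P x) (Q y) = ipL2 M (Q x) (gen M P y)"
proof -
  interpret contraction_sg M P by fact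
  note xp = gen_props[OF x] and yp = gen_props[OF y]
  have eq: "ipL2 M (P t x) (Q y) = ipL2 M (Q x) (P t y)" if t: "t > 0" for t
  proof -
    have "ipL2 M (P t x) (Q y) = ipL2 M x (Q (P t (Q (Q y))))"
      using sa xp yp t by (simp add: Q_selfadjoint_def)
    also have "\<dots> = ipL2 M x (Q (P t y))"
      using xp yp t by (intro ipL2_cong_right Q_cong P_cong Q_Q) auto
    finally show ?thesis using xp yp t by (simp add: ipL2_Q_left)
  qed
  have 1: "((\<lambda>t. ipL2 M (\<lambda>z. (P t x z - x z) / t) (Q y)) \<longlongrightarrow> ipL2 M (gen M P x) (Q y)) (at_right 0)"
    using xp yp quotient_L2 by (intro tendsL2_ipL2_left) auto
  have 2: "((\<lambda>t. ipL2 M (Q x) (\<lambda>z. (P t y z - y z) / t)) \<longlongrightarrow> ipL2 M (Q x) (gen M P y)) (at_right 0)"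
    using xp yp quotient_L2 by (intro tendsL2_ipL2_right) auto
  have "eventually (\<lambda>t. ipL2 M (\<lambda>z. (P t x z - x z) / t) (Q y) = ipL2 M (Q x) (\<lambda>z. (P t y z - y z) / t)) (at_right 0)"
    using eventually_at_right_less
  proof eventually_elim
    case (elim t)
    then show ?case using xp(1) yp(1) eq[OF elim] by (simp add: ipL2_linear ipL2_Q_left)
  qed
  from tendsto_cong[OF this] 1 2 show ?thesis
    by (intro tendsto_unique[of "at_right (0::real)"]) auto
qed

end

section \<open>Interpolating between two Q-self-adjoint generators\<close>

text \<open>\<open>form_nonneg\<close> is the common content of the two alternative sign conditions:
  the first gives it directly, the second when evaluated at \<open>Q g\<close>, which stays in
  \<open>A\<close>.\<close>

locale Q_interpolation = prob_space M + isometric_involution M Q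
  for M :: "'e measure" and Q +
  fixes P1 P2 :: "real \<Rightarrow> ('e \<Rightarrow> real) \<Rightarrow> ('e \<Rightarrow> real)"
    and A :: "('e \<Rightarrow> real) set"
    and Pb :: "real \<Rightarrow> real \<Rightarrow> ('e \<Rightarrow> real) \<Rightarrow> ('e \<Rightarrow> real)"
  assumes P1: "contraction_sg M P1" and sa1: "Q_selfadjoint M Q P1"
    and P2: "contraction_sg M P2" and sa2: "Q_selfadjoint M Q P2"
    and A_dom: "A \<subseteq> gen_dom M P1 \<inter> gen_dom M P2"
    and A_lin: "\<And>f g a b. f \<in> A \<Longrightarrow> g \<in> A \<Longrightarrow> (\<lambda>x. a * f x + b * g x) \<in> A"
    and QA: "\<And>f. f \<in> A \<Longrightarrow> Q f \<in> A"
    and Pb: "\<And>\<beta>. \<beta> \<in> {1..2} \<Longrightarrow> invariant_core M (Pb \<beta>) A"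
    and gen_Pb: "\<And>\<beta> f. \<beta> \<in> {1..2} \<Longrightarrow> f \<in> gen_dom M P1 \<inter> gen_dom M P2 \<Longrightarrow>
       f \<in> gen_dom M (Pb \<beta>) \<and>
       eqL2 M (gen M (Pb \<beta>) f) (\<lambda>x. (2 - \<beta>) * gen M P1 f x + (\<beta> - 1) * gen M P2 f x)"
    and res_dom: "\<And>lam \<beta> f. lam > 0 \<Longrightarrow> \<beta> \<in> {1..2} \<Longrightarrow> f \<in> A \<Longrightarrow>
       resolvent M (Pb \<beta>) lam f \<in> gen_dom M P1 \<inter> gen_dom M P2"
    and form_nonneg: "\<And>g. g \<in> A \<Longrightarrow> 0 \<le> ipL2 M (Q g) (\<lambda>x. gen M P2 g x - gen M P1 g x)"
begin

abbreviation D where "D \<equiv> gen_dom M P1 \<inter> gen_dom M P2"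

definition B :: "('e \<Rightarrow> real) \<Rightarrow> 'e \<Rightarrow> real" where
  "B f = (\<lambda>x. gen M P2 f x - gen M P1 f x)"

definition q :: "('e \<Rightarrow> real) \<Rightarrow> ('e \<Rightarrow> real) \<Rightarrow> real" where
  "q f g = ipL2 M (Q f) (B g)"

lemma D_L2: "f \<in> D \<Longrightarrow> f \<in> L2 M"
  by (auto simp: gen_dom_def)

lemma gen1_L2: "f \<in> D \<Longrightarrow> gen M P1 f \<in> L2 M"
  using contraction_sg.gen_props(2)[OF P1] by auto

lemma gen2_L2: "f \<in> D \<Longrightarrow> gen M P2 f \<in> L2 M"
  using contraction_sg.gen_props(2)[OF P2] by auto

lemma genb_L2: "\<beta> \<in> {1..2} \<Longrightarrow> f \<in> D \<Longrightarrow> gen M (Pb \<beta>) f \<in> L2 M"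
  using contraction_sg.gen_props(2)[OF invariant_core.axioms(1)[OF Pb]] gen_Pb by blast

lemma B_L2: "f \<in> D \<Longrightarrow> B f \<in> L2 M"
  unfolding B_def using gen1_L2 gen2_L2 by auto

lemmas in_L2 = D_L2 gen1_L2 gen2_L2 genb_L2 B_L2

lemma A_D: "f \<in> A \<Longrightarrow> f \<in> D"
  using A_dom by auto

lemma D_lincomb: "f \<in> D \<Longrightarrow> g \<in> D \<Longrightarrow> (\<lambda>x. a * f x + b * g x) \<in> D"
  using contraction_sg.gen_lincomb(1)[OF P1] contraction_sg.gen_lincomb(1)[OF P2] by auto

lemma B_lincomb:
  assumes "f \<in> D" "g \<in> D"
  shows "eqL2 M (B (\<lambda>x. a * f x + b * g x)) (\<lambda>x. a * B f x + b * B g x)"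
  using assms unfolding B_def
  by (intro eqL2_imp2[OF contraction_sg.gen_lincomb(2)[OF P1, of f g a b]
      contraction_sg.gen_lincomb(2)[OF P2, of f g a b]]) (auto simp: algebra_simps)

section \<open>The symmetric form \<open>q\<close> and its domination by dissipation\<close>

lemma gen_sym:
  assumes "x \<in> D" "y \<in> D"
  shows "ipL2 M (gen M P1 x) (Q y) = ipL2 M (Q x) (gen M P1 y)"
    "ipL2 M (gen M P2 x) (Q y) = ipL2 M (Q x) (gen M P2 y)"
  using gen_Q_symmetric[OF P1 sa1, of x y] gen_Q_symmetric[OF P2 sa2, of x y] assms by auto

lemma q_sym:
  assumes "x \<in> D" "y \<in> D"
  shows "q x y = ipL2 M (B x) (Q y)" "q x y = q y x"
proof -
  show *: "q x y = ipL2 M (B x) (Q y)"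
    using assms gen_sym[OF assms] by (simp add: q_def B_def ipL2_linear in_L2)
  show "q x y = q y x" unfolding * by (simp add: q_def ipL2_commute)
qed

lemma q_quadratic:
  assumes x: "x \<in> D" and y: "y \<in> D"
  shows "q (\<lambda>z. a * x z + b * y z) (\<lambda>z. a * x z + b * y z) = a\<^sup>2 * q x x + 2 * a * b * q x y + b\<^sup>2 * q y y"
proof -
  let ?w = "\<lambda>z. a * x z + b * y z"
  have wD: "?w \<in> D" using D_lincomb[OF x y] .
  have "q ?w ?w = ipL2 M (\<lambda>z. a * Q x z + b * Q y z) (B ?w)"
    unfolding q_def using x y wD by (intro ipL2_cong_left Q_lincomb) (auto intro: in_L2 L2_lincomb)
  also have "\<dots> = ipL2 M (\<lambda>z. a * Q x z + b * Q y z) (\<lambda>z. a * B x z + b * B y z)"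
    using x y wD by (intro ipL2_cong_right B_lincomb) (auto intro: in_L2 L2_lincomb)
  also have "\<dots> = a\<^sup>2 * q x x + a * b * q x y + a * b * q y x + b\<^sup>2 * q y y"
    using x y by (simp add: q_def ipL2_linear in_L2 power2_eq_square algebra_simps)
  finally show ?thesis using q_sym(2)[OF y x] by simp
qed

lemma ipL2_genb:
  assumes "\<beta> \<in> {1..2}" "x \<in> D" "g \<in> L2 M"
  shows "ipL2 M g (gen M (Pb \<beta>) x) = (2 - \<beta>) * ipL2 M g (gen M P1 x) + (\<beta> - 1) * ipL2 M g (gen M P2 x)"
proof -
  have "ipL2 M g (gen M (Pb \<beta>) x) = ipL2 M g (\<lambda>z. (2 - \<beta>) * gen M P1 x z + (\<beta> - 1) * gen M P2 x z)"
    using assms gen_Pb[OF assms(1,2)] by (intro ipL2_cong_right) (auto intro: in_L2 L2_lincomb)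
  then show ?thesis using assms by (simp add: ipL2_linear in_L2)
qed

lemma genb_sym:
  assumes "\<beta> \<in> {1..2}" "x \<in> D" "y \<in> D"
  shows "ipL2 M (gen M (Pb \<beta>) x) (Q y) = ipL2 M (Q x) (gen M (Pb \<beta>) y)"
  using assms gen_sym[of x y] ipL2_genb[of \<beta> x "Q y"] ipL2_genb[of \<beta> y "Q x"]
  by (simp add: ipL2_commute[of M _ "Q y"] in_L2)

text \<open>Splitting \<open>x\<close> into its \<open>Q\<close>-even part \<open>p\<close> and \<open>Q\<close>-odd part \<open>m\<close>: the cross terms of the dissipation
  forms vanish, \<open>q p p\<close> is dominated by the dissipation of \<open>L\<^sub>1\<close> and \<open>q m m\<close> by that of \<open>L\<^sub>2\<close>.\<close>
lemma form_le_dissipation: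
  assumes \<beta>: "\<beta> \<in> {1..2}" and x: "x \<in> A"
  shows "min (2 - \<beta>) (\<beta> - 1) * q x x \<le> - 2 * ipL2 M x (gen M (Pb \<beta>) x)"
proof -
  define p where "p = (\<lambda>z. (1/2) * x z + (1/2) * Q x z)"
  define m where "m = (\<lambda>z. (1/2) * x z + (-1/2) * Q x z)"
  have pA: "p \<in> A" and mA: "m \<in> A" unfolding p_def m_def using x QA A_lin by blast+
  have pD: "p \<in> D" and mD: "m \<in> D" and xD: "x \<in> D" using pA mA x A_D by auto
  have xL: "x \<in> L2 M" using xD D_L2 by auto
  have xpm: "x = (\<lambda>z. 1 * p z + 1 * m z)" by (auto simp: p_def m_def)
  have Qp: "eqL2 M (Q p) p" unfolding p_def
    by (rule eqL2_imp2[OF Q_lincomb[of x "Q x" "1/2" "1/2"] Q_Q[OF xL]]) (use xL in \<open>auto simp: algebra_simps\<close>)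
  have Qm: "eqL2 M (Q m) (\<lambda>z. - m z)" unfolding m_def
    by (rule eqL2_imp2[OF Q_lincomb[of x "Q x" "1/2" "-1/2"] Q_Q[OF xL]]) (use xL in \<open>auto simp: algebra_simps\<close>)
  have ipQp: "ipL2 M (Q p) g = ipL2 M p g" if "g \<in> L2 M" for g
    using Qp pD that by (intro ipL2_cong_left) (auto intro: in_L2)
  have ipQm: "ipL2 M (Q m) g = - ipL2 M m g" if "g \<in> L2 M" for g
  proof -
    have "ipL2 M (Q m) g = ipL2 M (\<lambda>z. - m z) g"
      using Qm mD that by (intro ipL2_cong_left) (auto intro: in_L2)
    then show ?thesis by (simp add: ipL2_linear)
  qed
  have split: "ipL2 M x (gen M P x) = ipL2 M p (gen M P p) + ipL2 M m (gen M P m)"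
    if P: "contraction_sg M P" and sa: "Q_selfadjoint M Q P" and dom: "p \<in> gen_dom M P" "m \<in> gen_dom M P" for P
  proof -
    interpret contraction_sg M P by fact
    note pp = gen_props[OF dom(1)] and mp = gen_props[OF dom(2)]
    have w: "x \<in> gen_dom M P" and e: "eqL2 M (gen M P x) (\<lambda>z. 1 * gen M P p z + 1 * gen M P m z)"
      unfolding xpm by (rule gen_lincomb[OF dom])+
    have "ipL2 M x (gen M P x) = ipL2 M x (\<lambda>z. 1 * gen M P p z + 1 * gen M P m z)"
      using e gen_props[OF w] pp mp by (intro ipL2_cong_right) auto
    also have "\<dots> = ipL2 M (\<lambda>z. 1 * p z + 1 * m z) (\<lambda>z. 1 * gen M P p z + 1 * gen M P m z)"
      by (simp only: xpm[symmetric])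
    also have "\<dots> = ipL2 M p (gen M P p) + ipL2 M p (gen M P m) + ipL2 M m (gen M P p) + ipL2 M m (gen M P m)"
      using pp mp by (simp add: ipL2_linear)
    finally have 1: "ipL2 M x (gen M P x) = \<dots>" .
    \<comment> \<open>Since \<open>Q\<close> fixes \<open>p\<close> and negates \<open>m\<close>,
      symmetry makes the two cross terms opposite: they cancel as a sum, not individually.\<close>
    have "ipL2 M (gen M P p) (Q m) = ipL2 M (Q p) (gen M P m)"
      by (rule gen_Q_symmetric[OF P sa dom])
    then have "- ipL2 M m (gen M P p) = ipL2 M p (gen M P m)"
      using pp mp ipQp[of "gen M P m"] ipQm[of "gen M P p"] by (simp add: ipL2_commute[of M _ "Q m"])
    then show ?thesis using 1 by simp
  qed
  have s1: "ipL2 M x (gen M P1 x) = ipL2 M p (gen M P1 p) + ipL2 M m (gen M P1 m)"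
    using split[OF P1 sa1] pD mD by auto
  have s2: "ipL2 M x (gen M P2 x) = ipL2 M p (gen M P2 p) + ipL2 M m (gen M P2 m)"
    using split[OF P2 sa2] pD mD by auto
  have diss: "ipL2 M w (gen M P1 w) \<le> 0" "ipL2 M w (gen M P2 w) \<le> 0" if "w \<in> D" for w
    using contraction_sg.gen_dissipative[OF P1] contraction_sg.gen_dissipative[OF P2] that by auto
  have qp: "q p p = ipL2 M p (gen M P2 p) - ipL2 M p (gen M P1 p)"
    using pD unfolding q_def B_def by (subst ipQp) (auto simp: ipL2_linear in_L2)
  have qm: "q m m = ipL2 M m (gen M P1 m) - ipL2 M m (gen M P2 m)"
    using mD unfolding q_def B_def by (subst ipQm) (auto simp: ipL2_linear in_L2)
  have q0: "0 \<le> q w w" if "w \<in> A" for w using form_nonneg[OF that] by (simp add: q_def B_def)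
  have qx: "q x x = q p p + 2 * q p m + q m m"
    using q_quadratic[OF pD mD, of 1 1] xpm by simp
  \<comment> \<open>Positivity on \<open>p - m\<close> bounds the mixed term by the diagonal ones;
    this is the origin of the factor 2 in the conclusion.\<close>
  have "0 \<le> q p p - 2 * q p m + q m m"
    using q0[OF A_lin[OF pA mA, of 1 "-1"]] q_quadratic[OF pD mD, of 1 "-1"] by simp
  then have qx_le: "q x x \<le> 2 * (q p p + q m m)" using qx by simp
  \<comment> \<open>The smaller weight is at most the weight \<open>2 - \<beta>\<close> of the first
    generator, used on \<open>p\<close>, and at most the weight \<open>\<beta> - 1\<close> of the
    second, used on \<open>m\<close>.\<close>
  let ?\<kappa> = "min (2 - \<beta>) (\<beta> - 1)"
  have "?\<kappa> * q x x \<le> ?\<kappa> * (2 * (q p p + q m m))"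
    using qx_le \<beta> by (intro mult_left_mono) auto
  also have "\<dots> = 2 * (?\<kappa> * q p p) + 2 * (?\<kappa> * q m m)" by (simp add: algebra_simps)
  also have "\<dots> \<le> 2 * ((2 - \<beta>) * q p p) + 2 * ((\<beta> - 1) * q m m)"
    using q0[OF pA] q0[OF mA] by (intro add_mono mult_left_mono mult_right_mono) auto
  also have "\<dots> \<le> 2 * ((2 - \<beta>) * (- ipL2 M p (gen M P1 p))) + 2 * ((\<beta> - 1) * (- ipL2 M m (gen M P2 m)))"
    using \<beta> diss[OF pD] diss[OF mD] unfolding qp qm by (intro add_mono mult_left_mono) auto
  \<comment> \<open>The remaining dissipation, of the first generator on \<open>m\<close> and of the
    second on \<open>p\<close>, has the favourable sign and is added.\<close>
  also have "\<dots> \<le> - 2 * ((2 - \<beta>) * ipL2 M x (gen M P1 x) + (\<beta> - 1) * ipL2 M x (gen M P2 x))"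
    using \<beta> mult_nonneg_nonpos[of "2 - \<beta>" "ipL2 M m (gen M P1 m)"]
      mult_nonneg_nonpos[of "\<beta> - 1" "ipL2 M p (gen M P2 p)"] diss[OF pD] diss[OF mD]
    unfolding s1 s2 by (simp add: algebra_simps)
  also have "\<dots> = - 2 * ipL2 M x (gen M (Pb \<beta>) x)"
    using ipL2_genb[OF \<beta> xD xL] by simp
  finally show ?thesis .
qed

section \<open>Resolvents of the interpolated generators\<close>

lemma resolvent_eq:
  assumes "lam > 0" "\<beta> \<in> {1..2}" "f \<in> A"
  shows "eqL2 M (\<lambda>z. lam * resolvent M (Pb \<beta>) lam f z - gen M (Pb \<beta>) (resolvent M (Pb \<beta>) lam f) z) f"
proof -
  interpret invariant_core M "Pb \<beta>" A using assms by (intro Pb)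
  show ?thesis
    by (rule eqL2_imp[OF gen_resolvent(2)[OF assms(1) A_L2[OF assms(3)]]]) simp
qed

lemma ipL2_resolvent_eq:
  assumes "lam > 0" "\<beta> \<in> {1..2}" "f \<in> A" "g \<in> L2 M"
  shows "ipL2 M g f = lam * ipL2 M g (resolvent M (Pb \<beta>) lam f) - ipL2 M g (gen M (Pb \<beta>) (resolvent M (Pb \<beta>) lam f))"
proof -
  let ?u = "resolvent M (Pb \<beta>) lam f"
  have uD: "?u \<in> D" using assms by (intro res_dom)
  have "ipL2 M g f = ipL2 M g (\<lambda>z. lam * ?u z - gen M (Pb \<beta>) ?u z)"
    using resolvent_eq[OF assms(1-3)] assms(4) D_L2[OF uD] genb_L2[OF assms(2) uD] D_L2[OF A_D[OF assms(3)]]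
    by (intro ipL2_cong_right eqL2_sym[of M _ f]) auto
  then show ?thesis using assms uD by (simp add: ipL2_linear in_L2)
qed

text \<open>For general \<open>w\<close> the resolvent is not known to lie in the common domain,
  where symmetry of L(\<beta>) is available, so the computation is done on approximants from
  \<open>A\<close>. The generality serves the case where \<open>w\<close> is \<open>B\<close> of a
  resolvent.\<close>

lemma resolvent_Q_symmetric:
  assumes lam: "lam > 0" and \<beta>: "\<beta> \<in> {1..2}" and f: "f \<in> A" and w: "w \<in> L2 M"
  shows "ipL2 M (resolvent M (Pb \<beta>) lam w) (Q f) = ipL2 M (Q w) (resolvent M (Pb \<beta>) lam f)"
proof -
  interpret b: invariant_core M "Pb \<beta>" A using \<beta> by (intro Pb)
  let ?u = "resolvent M (Pb \<beta>) lam f"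
  have uD: "?u \<in> D" using lam \<beta> f by (intro res_dom)
  have fL: "f \<in> L2 M" using A_D[OF f] D_L2 by auto
  obtain x where x: "\<And>n. x n \<in> A" "tendsL2 M (\<lambda>n y. lam * x n y - gen M (Pb \<beta>) (x n) y) w sequentially"
    "tendsL2 M x (resolvent M (Pb \<beta>) lam w) sequentially" "resolvent M (Pb \<beta>) lam w \<in> L2 M"
    using b.resolvent_approx[OF lam w] by metis
  have xD: "x n \<in> D" for n using x(1) A_D by auto
  have eq: "ipL2 M (x n) (Q f) = ipL2 M (\<lambda>y. lam * x n y - gen M (Pb \<beta>) (x n) y) (Q ?u)" for n
  proof -
    have "ipL2 M (x n) (Q f) = ipL2 M (Q (x n)) f"
      using xD[of n] fL by (simp add: ipL2_Q_left in_L2)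
    also have "\<dots> = lam * ipL2 M (Q (x n)) ?u - ipL2 M (Q (x n)) (gen M (Pb \<beta>) ?u)"
      using lam \<beta> f xD[of n] by (intro ipL2_resolvent_eq) (auto intro: in_L2)
    also have "\<dots> = lam * ipL2 M (x n) (Q ?u) - ipL2 M (gen M (Pb \<beta>) (x n)) (Q ?u)"
      using xD[of n] uD \<beta> by (simp add: ipL2_Q_left in_L2 genb_sym)
    also have "\<dots> = ipL2 M (\<lambda>y. lam * x n y - gen M (Pb \<beta>) (x n) y) (Q ?u)"
      using xD[of n] uD \<beta> by (simp add: ipL2_linear in_L2)
    finally show ?thesis .
  qed
  have "(\<lambda>n. ipL2 M (x n) (Q f)) \<longlonglongrightarrow> ipL2 M (resolvent M (Pb \<beta>) lam w) (Q f)"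
    using x D_L2[OF xD] fL by (intro tendsL2_ipL2_left) auto
  moreover have "(\<lambda>n. ipL2 M (x n) (Q f)) \<longlonglongrightarrow> ipL2 M w (Q ?u)"
    unfolding eq using x(2) D_L2[OF xD] genb_L2[OF \<beta> xD] D_L2[OF uD] w by (intro tendsL2_ipL2_left) auto
  ultimately have "ipL2 M (resolvent M (Pb \<beta>) lam w) (Q f) = ipL2 M w (Q ?u)" by (rule LIMSEQ_unique)
  then show ?thesis using w uD by (simp add: ipL2_Q_left in_L2)
qed

text \<open>Convergence of \<open>?L (x n)\<close> does not give convergence of
  \<open>B (x n)\<close>, so diagonal values of \<open>q\<close> cannot be passed to the limit
  directly. The mixed values \<open>q (x n) (x m)\<close> can, one index at a time.\<close>

lemma form_resolvent_nonneg:
  assumes lam: "lam > 0" and \<beta>: "1 < \<beta>" "\<beta> < 2" and f: "f \<in> A"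
  shows "0 \<le> q (resolvent M (Pb \<beta>) lam f) (resolvent M (Pb \<beta>) lam f)"
proof -
  have b12: "\<beta> \<in> {1..2}" using \<beta> by auto
  interpret b: invariant_core M "Pb \<beta>" A using b12 by (intro Pb)
  let ?L = "gen M (Pb \<beta>)"
  define u where "u = resolvent M (Pb \<beta>) lam f"
  define v where "v = (\<lambda>y. lam * u y - f y)"
  have uD: "u \<in> D" unfolding u_def using lam b12 f by (intro res_dom)
  have fL: "f \<in> L2 M" using A_D[OF f] D_L2 by auto
  have vL: "v \<in> L2 M" unfolding v_def using uD fL D_L2 by auto
  have uL: "u \<in> L2 M" using uD D_L2 by auto
  obtain x where x: "\<And>n. x n \<in> A" "tendsL2 M x u sequentially" "tendsL2 M (\<lambda>n. ?L (x n)) v sequentially"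
    using b.resolvent_approx_gen[OF lam fL] unfolding u_def v_def by metis
  have xD: "x n \<in> D" for n using x(1) A_D by auto
  have xL: "x n \<in> L2 M" and LxL: "?L (x n) \<in> L2 M" for n using xD b12 by (auto intro: in_L2)
  define \<kappa> where "\<kappa> = min (2 - \<beta>) (\<beta> - 1)"
  have \<kappa>: "\<kappa> > 0" using \<beta> by (simp add: \<kappa>_def)
  have q0: "0 \<le> q w w" if "w \<in> A" for w using form_nonneg[OF that] by (simp add: q_def B_def)
  \<comment> \<open>Dropping the two nonnegative diagonal values turns the domination of
    \<open>q\<close> on \<open>x n - x m\<close> into a lower bound for the mixed value.\<close>
  have lower: "ipL2 M (\<lambda>y. x n y - x m y) (\<lambda>y. ?L (x n) y - ?L (x m) y) \<le> \<kappa> * q (x n) (x m)" for n m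
  proof -
    let ?d = "\<lambda>y. 1 * x n y + (-1) * x m y"
    have dA: "?d \<in> A" using x(1) A_lin by blast
    have dD: "?d \<in> D" using A_D[OF dA] .
    have "q ?d ?d = q (x n) (x n) - 2 * q (x n) (x m) + q (x m) (x m)"
      using q_quadratic[OF xD[of n] xD[of m], of 1 "-1"] by simp
    then have "- 2 * q (x n) (x m) \<le> q ?d ?d" using q0[OF x(1)[of n]] q0[OF x(1)[of m]] by linarith
    then have "\<kappa> * (- 2 * q (x n) (x m)) \<le> \<kappa> * q ?d ?d" using \<kappa> by (intro mult_left_mono) auto
    also have "\<dots> \<le> - 2 * ipL2 M ?d (?L ?d)"
      unfolding \<kappa>_def by (rule form_le_dissipation[OF b12 dA])
    finally have "ipL2 M ?d (?L ?d) \<le> \<kappa> * q (x n) (x m)" by simp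
    moreover have "ipL2 M ?d (?L ?d) = ipL2 M ?d (\<lambda>y. 1 * ?L (x n) y + (-1) * ?L (x m) y)"
    proof (rule ipL2_cong_right)
      show "eqL2 M (?L ?d) (\<lambda>y. 1 * ?L (x n) y + (-1) * ?L (x m) y)"
        using gen_Pb[OF b12] xD by (intro b.gen_lincomb(2)) auto
    qed (use dD b12 LxL in \<open>auto intro: in_L2 L2_lincomb\<close>)
    ultimately show ?thesis by simp
  qed
  \<comment> \<open>The first limit is in \<open>n\<close>; \<open>B (x m)\<close> is a fixed vector
    here.\<close>
  have lower': "ipL2 M (\<lambda>y. u y - x m y) (\<lambda>y. v y - ?L (x m) y) \<le> \<kappa> * q u (x m)" for m
  proof (rule LIMSEQ_le)
    have "tendsL2 M (\<lambda>n y. 1 * x n y + (-1) * x m y) (\<lambda>y. 1 * u y + (-1) * x m y) sequentially"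
      using x xL uL by (intro tendsL2_lincomb tendsL2_const) auto
    moreover have "tendsL2 M (\<lambda>n y. 1 * ?L (x n) y + (-1) * ?L (x m) y) (\<lambda>y. 1 * v y + (-1) * ?L (x m) y) sequentially"
      using x LxL vL by (intro tendsL2_lincomb tendsL2_const) auto
    ultimately show "(\<lambda>n. ipL2 M (\<lambda>y. x n y - x m y) (\<lambda>y. ?L (x n) y - ?L (x m) y))
      \<longlonglongrightarrow> ipL2 M (\<lambda>y. u y - x m y) (\<lambda>y. v y - ?L (x m) y)"
      using xL uL LxL vL by (intro tendsL2_ipL2) auto
    show "(\<lambda>n. \<kappa> * q (x n) (x m)) \<longlonglongrightarrow> \<kappa> * q u (x m)"
      unfolding q_def using x xL uL xD[of m]
      by (intro tendsto_intros tendsL2_ipL2_left tendsL2_Q) (auto intro: in_L2)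
  qed (use lower in auto)
  \<comment> \<open>The second limit is in \<open>m\<close>. By symmetry of \<open>q\<close> the
    moving vector is \<open>Q (x m)\<close>, paired with the fixed \<open>B u\<close>; the left side
    becomes 0.\<close>
  have "ipL2 M (\<lambda>y. u y - u y) (\<lambda>y. v y - v y) \<le> \<kappa> * q u u"
  proof (rule LIMSEQ_le)
    have "tendsL2 M (\<lambda>n y. 1 * u y + (-1) * x n y) (\<lambda>y. 1 * u y + (-1) * u y) sequentially"
      using x xL uL by (intro tendsL2_lincomb tendsL2_const) auto
    moreover have "tendsL2 M (\<lambda>n y. 1 * v y + (-1) * ?L (x n) y) (\<lambda>y. 1 * v y + (-1) * v y) sequentially"
      using x LxL vL by (intro tendsL2_lincomb tendsL2_const) auto
    ultimately show "(\<lambda>m. ipL2 M (\<lambda>y. u y - x m y) (\<lambda>y. v y - ?L (x m) y))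
      \<longlonglongrightarrow> ipL2 M (\<lambda>y. u y - u y) (\<lambda>y. v y - v y)"
      using xL uL LxL vL by (intro tendsL2_ipL2 L2_diff) auto
    show "(\<lambda>m. \<kappa> * q u (x m)) \<longlonglongrightarrow> \<kappa> * q u u"
      unfolding q_sym(1)[OF uD xD] q_sym(1)[OF uD uD] using x xL uL uD
      by (intro tendsto_intros tendsL2_ipL2_right tendsL2_Q) (auto intro: in_L2)
  qed (use lower' in auto)
  then have "0 \<le> \<kappa> * q u u" by (simp add: ipL2_def)
  then show ?thesis using \<kappa> by (simp add: zero_le_mult_iff u_def)
qed

text \<open>Second resolvent identity: \<open>lam - L(c)\<close> maps the difference to
  \<open>(c - b)\<close> times \<open>B\<close> of the resolvent at \<open>b\<close>, and the a
  priori bound for L(c) applies. The constant involves only the resolvent at \<open>b\<close>, as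
  continuity at \<open>b\<close> demands.\<close>

lemma resolvent_lipschitz:
  assumes lam: "lam > 0" and b: "b \<in> {1..2}" and c: "c \<in> {1..2}" and f: "f \<in> A"
  shows "nrmL2 M (\<lambda>y. resolvent M (Pb c) lam f y - resolvent M (Pb b) lam f y)
    \<le> \<bar>c - b\<bar> * (nrmL2 M (B (resolvent M (Pb b) lam f)) / lam)"
proof -
  interpret c: invariant_core M "Pb c" A using c by (intro Pb)
  let ?u = "resolvent M (Pb b) lam f" and ?u' = "resolvent M (Pb c) lam f"
  have uD: "?u \<in> D" "?u' \<in> D" by (rule res_dom[OF lam b f]) (rule res_dom[OF lam c f])
  let ?d = "\<lambda>y. 1 * ?u' y + (-1) * ?u y"
  have dD: "?d \<in> D" using uD by (intro D_lincomb)
  have gd: "?d \<in> gen_dom M (Pb c)" using gen_Pb[OF c dD] by auto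
  have e1: "eqL2 M (gen M (Pb c) ?d) (\<lambda>y. 1 * gen M (Pb c) ?u' y + (-1) * gen M (Pb c) ?u y)"
    using gen_Pb[OF c] uD by (intro c.gen_lincomb(2)) auto
  have e2: "eqL2 M (\<lambda>y. gen M (Pb c) ?u y - gen M (Pb b) ?u y) (\<lambda>y. (c - b) * B ?u y)"
    by (rule eqL2_imp2[OF conjunct2[OF gen_Pb[OF c uD(1)]] conjunct2[OF gen_Pb[OF b uD(1)]]])
       (simp add: B_def algebra_simps)
  have e3: "eqL2 M (\<lambda>y. lam * ?u' y - gen M (Pb c) ?u' y) (\<lambda>y. lam * ?u y - gen M (Pb b) ?u y)"
    by (rule eqL2_imp2[OF resolvent_eq[OF lam c f] resolvent_eq[OF lam b f]]) simp
  have "eqL2 M (\<lambda>y. lam * ?d y - gen M (Pb c) ?d y) (\<lambda>y. (c - b) * B ?u y)"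
    by (rule eqL2_imp3[OF e1 e2 e3]) (simp add: algebra_simps)
  then have "nrmL2 M (\<lambda>y. lam * ?d y - gen M (Pb c) ?d y) = nrmL2 M (\<lambda>y. (c - b) * B ?u y)"
    using D_L2[OF dD] genb_L2[OF c dD] B_L2[OF uD(1)] by (intro nrmL2_cong L2_diff L2_scale)
  with c.nrmL2_le_range[OF lam gd] show ?thesis by (simp add: nrmL2_scale)
qed

text \<open>Write \<open>f\<close> as \<open>(lam - L(b)) ?u\<close> in one term and as
  \<open>(lam - L(c)) ?u'\<close> in the other. As \<open>Q\<close> fixes \<open>f\<close>, a
  \<open>Q\<close> can be inserted; the \<open>lam\<close> terms then cancel, and symmetry lets L(c)
  - L(b) act on \<open>?u\<close> alone.\<close>

lemma resolvent_form_increment: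
  assumes lam: "lam > 0" and b: "b \<in> {1..2}" and c: "c \<in> {1..2}" and f: "f \<in> A" and Qf: "eqL2 M (Q f) f"
  shows "ipL2 M f (resolvent M (Pb c) lam f) - ipL2 M f (resolvent M (Pb b) lam f)
    = (c - b) * q (resolvent M (Pb c) lam f) (resolvent M (Pb b) lam f)"
proof -
  let ?u = "resolvent M (Pb b) lam f" and ?u' = "resolvent M (Pb c) lam f"
  have uD: "?u \<in> D" "?u' \<in> D" by (rule res_dom[OF lam b f]) (rule res_dom[OF lam c f])
  have fL: "f \<in> L2 M" using A_D[OF f] D_L2 by auto
  have *: "ipL2 M f g = ipL2 M (Q g) f" if "g \<in> L2 M" for g
  proof -
    have "ipL2 M f g = ipL2 M (Q f) g"
      using Qf fL that by (intro ipL2_cong_left eqL2_sym[of M "Q f"]) auto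
    then show ?thesis using fL that by (simp add: ipL2_Q_left ipL2_commute[of M f])
  qed
  have "ipL2 M f ?u' = lam * ipL2 M (Q ?u') ?u - ipL2 M (Q ?u') (gen M (Pb b) ?u)"
    using * ipL2_resolvent_eq[OF lam b f, of "Q ?u'"] uD D_L2 by auto
  moreover have "ipL2 M f ?u = lam * ipL2 M (Q ?u) ?u' - ipL2 M (Q ?u) (gen M (Pb c) ?u')"
    using * ipL2_resolvent_eq[OF lam c f, of "Q ?u"] uD D_L2 by auto
  moreover have "ipL2 M (Q ?u) (gen M (Pb c) ?u') = ipL2 M (Q ?u') (gen M (Pb c) ?u)"
    using genb_sym[OF c uD] by (simp add: ipL2_commute[of M _ "Q ?u'"])
  moreover have "ipL2 M (Q ?u) ?u' = ipL2 M (Q ?u') ?u"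
    using uD D_L2 by (simp add: ipL2_Q_left ipL2_commute[of M ?u])
  moreover have "ipL2 M (Q ?u') (gen M (Pb c) ?u) - ipL2 M (Q ?u') (gen M (Pb b) ?u) = (c - b) * q ?u' ?u"
    using ipL2_genb[OF c uD(1), of "Q ?u'"] ipL2_genb[OF b uD(1), of "Q ?u'"] uD
    by (simp add: q_def B_def ipL2_linear in_L2 algebra_simps)
  ultimately show ?thesis by simp
qed

text \<open>The difference quotient equals \<open>q\<close> with the moving resolvent in the first
  slot and the fixed one in the second, so norm continuity of the resolvent in \<beta>
  suffices.\<close>

lemma resolvent_form_derivative:
  assumes lam: "lam > 0" and b: "b \<in> {1..2}" and f: "f \<in> A" and Qf: "eqL2 M (Q f) f"
  shows "((\<lambda>c. ipL2 M f (resolvent M (Pb c) lam f)) has_real_derivative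
     q (resolvent M (Pb b) lam f) (resolvent M (Pb b) lam f)) (at b within {1..2})"
proof -
  let ?u = "\<lambda>c. resolvent M (Pb c) lam f"
  have uD: "?u c \<in> D" if "c \<in> {1..2}" for c using that lam f by (intro res_dom)
  have ev: "eventually (\<lambda>c. c \<in> {1..2} \<and> c \<noteq> b) (at b within {1..2})"
    by (auto simp: eventually_at_filter)
  have "tendsL2 M ?u (?u b) (at b within {1..2})"
  proof (rule tendsL2_bound)
    show "eventually (\<lambda>c. nrmL2 M (\<lambda>y. ?u c y - ?u b y) \<le> \<bar>c - b\<bar> * (nrmL2 M (B (?u b)) / lam)) (at b within {1..2})"
      using ev by eventually_elim (rule resolvent_lipschitz[OF lam b _ f], blast)
    have "((\<lambda>c. \<bar>c - b\<bar> * (nrmL2 M (B (?u b)) / lam)) \<longlongrightarrow> \<bar>b - b\<bar> * (nrmL2 M (B (?u b)) / lam)) (at b within {1..2})"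
      by (intro tendsto_intros)
    then show "((\<lambda>c. \<bar>c - b\<bar> * (nrmL2 M (B (?u b)) / lam)) \<longlongrightarrow> 0) (at b within {1..2})" by simp
  qed
  then have "((\<lambda>c. q (?u c) (?u b)) \<longlongrightarrow> q (?u b) (?u b)) (at b within {1..2})"
    unfolding q_def using uD[OF b] ev
    by (intro tendsL2_ipL2_left tendsL2_Q) (auto elim!: eventually_mono intro!: in_L2 Q_L2 uD simp del: Int_iff)
  moreover have "eventually (\<lambda>c. q (?u c) (?u b) = (ipL2 M f (?u c) - ipL2 M f (?u b)) / (c - b)) (at b within {1..2})"
    using ev by eventually_elim (use lam b f Qf in \<open>simp add: resolvent_form_increment\<close>)
  ultimately show ?thesis
    unfolding has_field_derivative_iff using tendsto_cong by fast
qed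

text \<open>The sign of the derivative enters only for \<open>1 < b < 2\<close>; the endpoints are
  reached by continuity.\<close>

lemma resolvent_form_mono_core:
  assumes lam: "lam > 0" and f: "f \<in> A" and Qf: "eqL2 M (Q f) f"
  shows "ipL2 M f (resolvent M (Pb 1) lam f) \<le> ipL2 M f (resolvent M (Pb 2) lam f)"
proof (rule DERIV_nonneg_imp_increasing_open[of 1 2 "\<lambda>c. ipL2 M f (resolvent M (Pb c) lam f)"])
  show "\<exists>y. ((\<lambda>c. ipL2 M f (resolvent M (Pb c) lam f)) has_real_derivative y) (at b) \<and> 0 \<le> y"
    if b: "1 < b" "b < 2" for b
    using resolvent_form_derivative[OF lam _ f Qf, of b] form_resolvent_nonneg[OF lam b f] b
      at_within_interior[of b "{1..2}"] by auto
  show "continuous_on {1..2} (\<lambda>c. ipL2 M f (resolvent M (Pb c) lam f))"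
    by (rule DERIV_continuous_on) (rule resolvent_form_derivative[OF lam _ f Qf])
qed simp

lemma resolvent_form_mono:
  assumes lam: "lam > 0" and f: "f \<in> L2 M" and Qf: "eqL2 M (Q f) f"
  shows "ipL2 M f (resolvent M (Pb 1) lam f) \<le> ipL2 M f (resolvent M (Pb 2) lam f)"
proof -
  interpret b1: invariant_core M "Pb 1" A by (intro Pb) simp
  have "\<exists>a\<in>A. nrmL2 M (\<lambda>x. f x - a x) < inverse (real (Suc n))" for n
    using b1.A_dense f unfolding dense_L2_def by simp
  then obtain a where a: "\<And>n. a n \<in> A" "\<And>n. nrmL2 M (\<lambda>x. f x - a n x) < inverse (real (Suc n))" by metis
  have aL: "a n \<in> L2 M" for n using a A_D D_L2 by blast
  have af: "tendsL2 M a f sequentially"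
    using a(2) by (intro tendsL2_bound[OF _ LIMSEQ_inverse_real_of_nat])
      (auto simp: nrmL2_minus_commute[of M _ f] intro!: always_eventually less_imp_le)
  \<comment> \<open>Averaging with the image under \<open>Q\<close> stays in \<open>A\<close>,
    yields approximants fixed by \<open>Q\<close>, and still converges to \<open>f\<close> because
    \<open>Q\<close> fixes \<open>f\<close>.\<close>
  define g where "g n = (\<lambda>x. (1/2) * a n x + (1/2) * Q (a n) x)" for n
  have gA: "g n \<in> A" for n unfolding g_def using a QA A_lin by blast
  have gL: "g n \<in> L2 M" for n using gA A_D D_L2 by blast
  have Qg: "eqL2 M (Q (g n)) (g n)" for n unfolding g_def
    by (rule eqL2_imp2[OF Q_lincomb[of "a n" "Q (a n)" "1/2" "1/2"] Q_Q[OF aL]]) (use aL in \<open>auto simp: algebra_simps\<close>)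
  have "tendsL2 M g (\<lambda>x. (1/2) * f x + (1/2) * Q f x) sequentially"
    unfolding g_def using aL f af by (intro tendsL2_lincomb tendsL2_Q) auto
  moreover have "eqL2 M (\<lambda>x. (1/2) * f x + (1/2) * Q f x) f"
    by (rule eqL2_imp[OF Qf]) simp
  ultimately have gf: "tendsL2 M g f sequentially"
  proof -
    let ?f' = "\<lambda>x. (1/2) * f x + (1/2) * Q f x"
    assume h: "tendsL2 M g ?f' sequentially" "eqL2 M ?f' f"
    have f'L: "?f' \<in> L2 M" using f by (intro L2_lincomb) auto
    have "nrmL2 M (\<lambda>x. ?f' x - f x) = 0" using h(2) f f'L by (simp add: eqL2_iff_nrmL2)
    then have "nrmL2 M (\<lambda>y. g n y - f y) \<le> nrmL2 M (\<lambda>y. g n y - ?f' y)" for n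
      using nrmL2_triangle3[OF gL[of n] f'L f] by simp
    then show ?thesis using h(1) unfolding tendsL2_def[of M g ?f'] by (intro tendsL2_bound) auto
  qed
  have lim: "(\<lambda>n. ipL2 M (g n) (resolvent M (Pb b) lam (g n))) \<longlonglongrightarrow> ipL2 M f (resolvent M (Pb b) lam f)"
    if b: "b \<in> {1..2}" for b
  proof -
    interpret b: invariant_core M "Pb b" A using b by (intro Pb)
    have "tendsL2 M (\<lambda>n. resolvent M (Pb b) lam (g n)) (resolvent M (Pb b) lam f) sequentially"
    proof (rule tendsL2_bound)
      show "eventually (\<lambda>n. nrmL2 M (\<lambda>x. resolvent M (Pb b) lam (g n) x - resolvent M (Pb b) lam f x)
         \<le> nrmL2 M (\<lambda>x. g n x - f x) / lam) sequentially"
        using b.resolvent_bound_diff[OF lam gL f] by auto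
      show "(\<lambda>n. nrmL2 M (\<lambda>x. g n x - f x) / lam) \<longlonglongrightarrow> 0"
        using tendsto_divide[OF gf[unfolded tendsL2_def] tendsto_const[of lam]] lam by simp
    qed
    then show ?thesis using gf gL f b.resolvent_L2[OF lam] by (intro tendsL2_ipL2) auto
  qed
  show ?thesis
    using resolvent_form_mono_core[OF lam gA Qg] by (intro LIMSEQ_le[OF lim lim]) auto
qed

end

theorem theorem4p6:
  fixes M :: "'e measure"
    and Q :: "('e \<Rightarrow> real) \<Rightarrow> ('e \<Rightarrow> real)"
    and P1 P2 :: "real \<Rightarrow> ('e \<Rightarrow> real) \<Rightarrow> ('e \<Rightarrow> real)"
    and A :: "('e \<Rightarrow> real) set"
    and Pb :: "real \<Rightarrow> real \<Rightarrow> ('e \<Rightarrow> real) \<Rightarrow> ('e \<Rightarrow> real)"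
  assumes prob: "prob_space M"
    and Q: "iso_involution M Q"
    and P1: "sc_markov_semigroup M P1" "invariant_distr M P1" "Q_selfadjoint M Q P1"
    and P2: "sc_markov_semigroup M P2" "invariant_distr M P2" "Q_selfadjoint M Q P2"
    and core: "is_core M P1 A" "is_core M P2 A" "dense_L2 M A" "Q ` A \<subseteq> A"
    and ext: "\<forall>\<beta>\<in>{1..2}.
       sc_contraction_semigroup M (Pb \<beta>) \<and> invariant_distr M (Pb \<beta>) \<and>
       closed_generator M (Pb \<beta>) \<and>
       (\<forall>f\<in>gen_dom M P1 \<inter> gen_dom M P2. f \<in> gen_dom M (Pb \<beta>) \<and>
          eqL2 M (gen M (Pb \<beta>) f) (\<lambda>x. (2 - \<beta>) * gen M P1 f x + (\<beta> - 1) * gen M P2 f x)) \<and>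
       (\<forall>P'. sc_contraction_semigroup M P' \<and>
          (\<forall>f\<in>gen_dom M P1 \<inter> gen_dom M P2. f \<in> gen_dom M P' \<and>
             eqL2 M (gen M P' f) (\<lambda>x. (2 - \<beta>) * gen M P1 f x + (\<beta> - 1) * gen M P2 f x))
          \<longrightarrow> (\<forall>t\<ge>0. \<forall>f\<in>L2 M. eqL2 M (P' t f) (Pb \<beta> t f))) \<and>
       (\<forall>f\<in>A. \<forall>t\<ge>0. Pb \<beta> t f \<in> A)"
    and h1: "\<forall>lam>0. \<forall>\<beta>\<in>{1..2}. \<forall>f\<in>A.
       resolvent M (Pb \<beta>) lam f \<in> gen_dom M P1 \<inter> gen_dom M P2 \<and>
       (\<exists>g. (\<forall>n. g n \<in> A) \<and>
          convL2 M (\<lambda>n x. gen M P1 (g n) x - gen M P2 (g n) x)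
            (\<lambda>x. gen M P1 (resolvent M (Pb \<beta>) lam f) x - gen M P2 (resolvent M (Pb \<beta>) lam f) x))"
    and h2: "\<forall>lam>0. \<forall>f\<in>A.
       (\<forall>\<beta>\<in>{1..<2}.
          ((\<lambda>h. nrmL2 M (\<lambda>x. (resolvent M (Pb (\<beta> + h)) lam f x - resolvent M (Pb \<beta>) lam f x) / h
              - resolvent M (Pb \<beta>) lam
                  (\<lambda>y. gen M P2 (resolvent M (Pb \<beta>) lam f) y - gen M P1 (resolvent M (Pb \<beta>) lam f) y) x))
           \<longlongrightarrow> 0) (at_right 0)) \<and>
       continuous_on {1..<2} (\<lambda>\<beta>. ipL2 M f (resolvent M (Pb \<beta>) lam
          (\<lambda>y. gen M P2 (resolvent M (Pb \<beta>) lam f) y - gen M P1 (resolvent M (Pb \<beta>) lam f) y)))"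
    and h3: "(\<forall>g\<in>A. energy M g (\<lambda>h x. Q (gen M P1 h) x - Q (gen M P2 h) x) \<ge> 0) \<or>
             (\<forall>g\<in>A. energy M g (\<lambda>h x. gen M P1 (Q h) x - gen M P2 (Q h) x) \<ge> 0)"
  shows "(\<forall>lam>0. \<forall>f\<in>A. eqL2 M (Q f) f \<longrightarrow> (\<forall>\<beta>\<in>{1..<2}.
            ((\<lambda>b. ipL2 M f (resolvent M (Pb b) lam f)) has_real_derivative
               energy M (Q (resolvent M (Pb \<beta>) lam f)) (\<lambda>h x. gen M P1 (Q h) x - gen M P2 (Q h) x))
              (at \<beta> within {\<beta>..}) \<and>
            energy M (Q (resolvent M (Pb \<beta>) lam f)) (\<lambda>h x. gen M P1 (Q h) x - gen M P2 (Q h) x)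
              = energy M (resolvent M (Pb \<beta>) lam f) (\<lambda>h x. Q (gen M P1 h) x - Q (gen M P2 h) x) \<and>
            energy M (resolvent M (Pb \<beta>) lam f) (\<lambda>h x. Q (gen M P1 h) x - Q (gen M P2 h) x) \<ge> 0))
      \<and> (\<forall>lam>0. \<forall>f\<in>L2 M. eqL2 M (Q f) f \<longrightarrow>
            var_lam M P1 lam f = 2 * ipL2 M f (resolvent M (Pb 1) lam f) \<and>
            2 * ipL2 M f (resolvent M (Pb 1) lam f) \<le> 2 * ipL2 M f (resolvent M (Pb 2) lam f) \<and>
            2 * ipL2 M f (resolvent M (Pb 2) lam f) = var_lam M P2 lam f)"
proof -
  interpret prob_space M by (rule prob)
  interpret isometric_involution M Q using Q by unfold_locales
  have sg1: "sc_contraction_semigroup M P1" and sg2: "sc_contraction_semigroup M P2"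
    using markov_sc_contraction_semigroup[OF prob] P1 P2 by auto
  interpret C1: contraction_sg M P1 using sg1 by unfold_locales
  interpret C2: contraction_sg M P2 using sg2 by unfold_locales
  have A_lin: "\<And>f g a b. f \<in> A \<Longrightarrow> g \<in> A \<Longrightarrow> (\<lambda>x. a * f x + b * g x) \<in> A"
    and A_dom: "A \<subseteq> gen_dom M P1 \<inter> gen_dom M P2"
    using core(1,2) unfolding is_core_def by auto
  have QA: "Q f \<in> A" if "f \<in> A" for f using core(4) that by auto
  have energy1: "energy M g (\<lambda>h x. Q (gen M P1 h) x - Q (gen M P2 h) x)
      = ipL2 M (Q g) (\<lambda>x. gen M P2 g x - gen M P1 g x)"
    if g: "g \<in> gen_dom M P1 \<inter> gen_dom M P2" for g
    using g C1.gen_props[of g] C2.gen_props[of g]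
    by (simp add: energy_def ipL2_linear ipL2_Q_left)
  have energy2: "energy M (Q g) (\<lambda>h x. gen M P1 (Q h) x - gen M P2 (Q h) x)
      = ipL2 M (Q g) (\<lambda>x. gen M P2 g x - gen M P1 g x)"
    if g: "g \<in> gen_dom M P1 \<inter> gen_dom M P2" for g
  proof -
    have gL: "g \<in> L2 M" using g C1.gen_props by auto
    have "gen M P1 (Q (Q g)) = gen M P1 g" "gen M P2 (Q (Q g)) = gen M P2 g"
      using gL Q_Q[OF gL] by (auto intro: C1.gen_cong C2.gen_cong)
    then show ?thesis by (simp add: energy_def)
  qed
  have form_nonneg: "0 \<le> ipL2 M (Q g) (\<lambda>x. gen M P2 g x - gen M P1 g x)" if g: "g \<in> A" for g
  proof -
    have "g \<in> gen_dom M P1 \<inter> gen_dom M P2" using g A_dom by auto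
    then show ?thesis using h3 g QA[OF g] energy1[of g] energy2[of g] by auto
  qed
  interpret Q_interpolation M Q P1 P2 A Pb
  proof (intro Q_interpolation.intro Q_interpolation_axioms.intro)
    show "invariant_core M (Pb \<beta>) A" if \<beta>: "\<beta> \<in> {1..2}" for \<beta>
    proof
      show "A \<subseteq> gen_dom M (Pb \<beta>)" using ext[rule_format, OF \<beta>] A_dom by blast
      show "closed_generator M (Pb \<beta>)" "sc_contraction_semigroup M (Pb \<beta>)"
        "\<And>f t. f \<in> A \<Longrightarrow> 0 \<le> t \<Longrightarrow> Pb \<beta> t f \<in> A"
        using ext[rule_format, OF \<beta>] by blast+
    qed (fact A_lin core(3))+
    show "f \<in> gen_dom M (Pb \<beta>) \<and>
       eqL2 M (gen M (Pb \<beta>) f) (\<lambda>x. (2 - \<beta>) * gen M P1 f x + (\<beta> - 1) * gen M P2 f x)"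
      if "\<beta> \<in> {1..2}" "f \<in> gen_dom M P1 \<inter> gen_dom M P2" for \<beta> f
      using ext[rule_format, OF that(1)] that(2) by blast
    show "resolvent M (Pb \<beta>) lam f \<in> gen_dom M P1 \<inter> gen_dom M P2"
      if "lam > 0" "\<beta> \<in> {1..2}" "f \<in> A" for lam \<beta> f
      using h1 that by blast
  qed (fact P1(3) P2(3) A_dom A_lin QA form_nonneg C1.contraction_sg_axioms C2.contraction_sg_axioms
      prob_space_axioms isometric_involution_axioms)+
  \<comment> \<open>Identifies the derivative named in the differentiability hypothesis with the
    quadratic form, so that its assumed continuity in \<beta> becomes continuity of the
    form.\<close>
  have derivative: "ipL2 M f (resolvent M (Pb \<beta>) lam
        (\<lambda>y. gen M P2 (resolvent M (Pb \<beta>) lam f) y - gen M P1 (resolvent M (Pb \<beta>) lam f) y))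
      = q (resolvent M (Pb \<beta>) lam f) (resolvent M (Pb \<beta>) lam f)"
    if lam: "lam > 0" and \<beta>: "\<beta> \<in> {1..2}" and f: "f \<in> A" and Qf: "eqL2 M (Q f) f" for lam \<beta> f
  proof -
    interpret b: invariant_core M "Pb \<beta>" A using \<beta> by (rule Pb)
    let ?u = "resolvent M (Pb \<beta>) lam f"
    have uD: "?u \<in> D" using lam \<beta> f by (rule res_dom)
    note L = b.A_L2[OF f] B_L2[OF uD] D_L2[OF uD] b.resolvent_L2[OF lam B_L2[OF uD]]
    have "ipL2 M f (resolvent M (Pb \<beta>) lam (B ?u)) = ipL2 M (resolvent M (Pb \<beta>) lam (B ?u)) f"
      by (rule ipL2_commute)
    also have "\<dots> = ipL2 M (resolvent M (Pb \<beta>) lam (B ?u)) (Q f)"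
      using L Qf by (intro ipL2_cong_right eqL2_sym[of M "Q f"]) auto
    also have "\<dots> = ipL2 M (Q (B ?u)) ?u" using lam \<beta> f L(2) by (rule resolvent_Q_symmetric)
    also have "\<dots> = q ?u ?u" using L q_sym(1)[OF uD uD] by (simp add: ipL2_Q_left)
    finally show ?thesis by (simp add: B_def)
  qed
  have nonneg: "0 \<le> q (resolvent M (Pb \<beta>) lam f) (resolvent M (Pb \<beta>) lam f)"
    if lam: "lam > 0" and \<beta>: "\<beta> \<in> {1..<2}" and f: "f \<in> A" and Qf: "eqL2 M (Q f) f" for lam \<beta> f
  proof (cases "\<beta> = 1")
    case False
    then show ?thesis using \<beta> by (intro form_resolvent_nonneg lam f) auto
  next
    \<comment> \<open>At \<beta> = 1 the domination factor is 0, so the sign is inherited from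
      \<beta> > 1 by right continuity.\<close>
    case True
    let ?c = "\<lambda>b. q (resolvent M (Pb b) lam f) (resolvent M (Pb b) lam f)"
    have "continuous_on {1..<2} ?c"
      using h2[rule_format, OF lam f] derivative[OF lam _ f Qf]
      by (auto cong: continuous_on_cong_simp simp: simp_implies_def)
    then have "(?c \<longlongrightarrow> ?c 1) (at 1 within {1..<2})" by (auto simp: continuous_on_def)
    moreover have "at 1 within {1..<2::real} = at_right 1"
      by (rule at_within_nhd[of _ "{..<2}"]) auto
    ultimately have lim: "(?c \<longlongrightarrow> ?c 1) (at_right 1)" by simp
    have "eventually (\<lambda>b. 0 \<le> ?c b) (at_right 1)"
      unfolding eventually_at_right_field using form_resolvent_nonneg[OF lam _ _ f]
      by (intro exI[of _ 2]) auto
    then show ?thesis using True tendsto_lowerbound[OF lim] by simp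
  qed
  have right_deriv: "((\<lambda>b. ipL2 M f (resolvent M (Pb b) lam f)) has_real_derivative
      q (resolvent M (Pb \<beta>) lam f) (resolvent M (Pb \<beta>) lam f)) (at \<beta> within {\<beta>..})"
    if lam: "lam > 0" and \<beta>: "\<beta> \<in> {1..<2}" and f: "f \<in> A" and Qf: "eqL2 M (Q f) f" for lam \<beta> f
  proof -
    have "((\<lambda>b. ipL2 M f (resolvent M (Pb b) lam f)) has_real_derivative
        q (resolvent M (Pb \<beta>) lam f) (resolvent M (Pb \<beta>) lam f)) (at \<beta> within {\<beta>..2})"
      using \<beta> by (intro has_field_derivative_subset[OF resolvent_form_derivative[OF lam _ f Qf]]) auto
    \<comment> \<open>As \<beta> < 2, the half line and the interval up to 2 agree near \<beta>;
      beyond 2 nothing is known about \<open>Pb\<close>.\<close>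
    moreover have "at \<beta> within {\<beta>..} = at \<beta> within {\<beta>..2}"
      using \<beta> by (intro at_within_nhd[of _ "{..<2}"]) auto
    ultimately show ?thesis by simp
  qed
  have part1: "\<forall>lam>0. \<forall>f\<in>A. eqL2 M (Q f) f \<longrightarrow> (\<forall>\<beta>\<in>{1..<2}.
            ((\<lambda>b. ipL2 M f (resolvent M (Pb b) lam f)) has_real_derivative
               energy M (Q (resolvent M (Pb \<beta>) lam f)) (\<lambda>h x. gen M P1 (Q h) x - gen M P2 (Q h) x))
              (at \<beta> within {\<beta>..}) \<and>
            energy M (Q (resolvent M (Pb \<beta>) lam f)) (\<lambda>h x. gen M P1 (Q h) x - gen M P2 (Q h) x)
              = energy M (resolvent M (Pb \<beta>) lam f) (\<lambda>h x. Q (gen M P1 h) x - Q (gen M P2 h) x) \<and>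
            energy M (resolvent M (Pb \<beta>) lam f) (\<lambda>h x. Q (gen M P1 h) x - Q (gen M P2 h) x) \<ge> 0)"
  proof (intro allI impI ballI)
    fix lam :: real and f :: "'e \<Rightarrow> real" and \<beta> :: real
    assume h: "0 < lam" "f \<in> A" "eqL2 M (Q f) f" "\<beta> \<in> {1..<2}"
    let ?u = "resolvent M (Pb \<beta>) lam f"
    have "?u \<in> D" using h by (intro res_dom) auto
    then have "energy M (Q ?u) (\<lambda>h x. gen M P1 (Q h) x - gen M P2 (Q h) x) = q ?u ?u"
      "energy M ?u (\<lambda>h x. Q (gen M P1 h) x - Q (gen M P2 h) x) = q ?u ?u"
      using energy1 energy2 by (simp_all add: q_def B_def)
    then show "((\<lambda>b. ipL2 M f (resolvent M (Pb b) lam f)) has_real_derivative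
               energy M (Q ?u) (\<lambda>h x. gen M P1 (Q h) x - gen M P2 (Q h) x)) (at \<beta> within {\<beta>..}) \<and>
            energy M (Q ?u) (\<lambda>h x. gen M P1 (Q h) x - gen M P2 (Q h) x)
              = energy M ?u (\<lambda>h x. Q (gen M P1 h) x - Q (gen M P2 h) x) \<and>
            energy M ?u (\<lambda>h x. Q (gen M P1 h) x - Q (gen M P2 h) x) \<ge> 0"
      using right_deriv nonneg h by simp
  qed
  \<comment> \<open>At 1 and 2 one coefficient vanishes, so \<open>P1\<close> and \<open>P2\<close>
    themselves extend the combination; contractivity admits them to the uniqueness clause.\<close>
  have "eqL2 M (P1 t f) (Pb 1 t f)" "eqL2 M (P2 t f) (Pb 2 t f)" if "t \<ge> 0" "f \<in> L2 M" for t f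
  proof -
    have "\<forall>f\<in>D. f \<in> gen_dom M P1 \<and> eqL2 M (gen M P1 f) (\<lambda>x. (2 - 1) * gen M P1 f x + (1 - 1) * gen M P2 f x)"
      by (simp add: eqL2_def)
    then show "eqL2 M (P1 t f) (Pb 1 t f)"
      using ext[rule_format, of 1] sg1 that by auto
    have "\<forall>f\<in>D. f \<in> gen_dom M P2 \<and> eqL2 M (gen M P2 f) (\<lambda>x. (2 - 2) * gen M P1 f x + (2 - 1) * gen M P2 f x)"
      by (simp add: eqL2_def)
    then show "eqL2 M (P2 t f) (Pb 2 t f)"
      using ext[rule_format, of 2] sg2 that by auto
  qed
  moreover have "Pb \<beta> t f \<in> L2 M" if "\<beta> \<in> {1..2}" "t \<ge> 0" "f \<in> L2 M" for \<beta> t f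
    using contraction_sg.P_L2[OF invariant_core.axioms(1)[OF Pb]] that by blast
  ultimately have "resolvent M P1 lam f = resolvent M (Pb 1) lam f"
    "resolvent M P2 lam f = resolvent M (Pb 2) lam f" if "f \<in> L2 M" for lam f
    using that by (auto intro!: resolvent_cong)
  then have part2: "\<forall>lam>0. \<forall>f\<in>L2 M. eqL2 M (Q f) f \<longrightarrow>
            var_lam M P1 lam f = 2 * ipL2 M f (resolvent M (Pb 1) lam f) \<and>
            2 * ipL2 M f (resolvent M (Pb 1) lam f) \<le> 2 * ipL2 M f (resolvent M (Pb 2) lam f) \<and>
            2 * ipL2 M f (resolvent M (Pb 2) lam f) = var_lam M P2 lam f"
    using resolvent_form_mono by (simp add: var_lam_def)
  from part1 part2 show ?thesis by (rule conjI)
qed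

end
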